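(* Let $r\ge2$, let $P$ be a collectable $r$-pattern whose composition $\lambda_P$ has $s$ components, and let $\pi$ be a partition $[s]=T_0\cup T_1\cup\cdots\cup T_t$ into $t+1$ nonempty parts with $1\in T_0$. Then there are constants $0<c<C$ such that asymptotically almost surely \[ c\,n^{1/(r-t)}\le z_{\mathcal{C}(P,\pi)}(\mathbb{RM}^{(r)}_{n})\le C\,n^{1/(r-t)}. \]
   Context: An ordered $r$-matching of size $n$ is a set of $n$ pairwise disjoint $r$-element subsets (edges) of a linearly ordered set of $rn$ vertices. Two ordered hypergraphs are order-isomorphic if there is an order-preserving isomorphism. An $r$-pattern is an ordered $r$-matching of size 2 (up to order-isomorphism), written as a word of length $2r$ in letters $A,B$, each occurring $r$ times, beginning with $A$ (words that differ by exchanging $A$ and $B$ represent the same pattern). An $r$-pattern $P$ is collectable if it can be split into consecutive blocks $P=S_1\cdots S_s$, each of the form $A^tB^t$ or $B^tA^t$ for some $t\ge1$ (depending on the block); the splitting is unique and $\lambda_P=(\lambda_1,\dots,\lambda_s)$, $\lambda_i=|S_i|/2$, is its composition. Given such $P$ and a partition $\pi$: $[s]=T_0\cup\cdots\cup T_t$ with all parts nonempty and $1\in T_0$, the mega-block $P_j$ consists of the blocks $S_i$ with $i\in T_j$. For $F\subseteq[t]$, $P_F$ is the pattern obtained from $P$ by flipping (exchanging $A\leftrightarrow B$ in) all positions belonging to the mega-blocks $P_j$ with $j\in F$. The $t$-cube is $\mathcal{C}(P,\pi)=\{P_F: F\subseteq[t]\}$. For a set $\mathcal{P}$ of $r$-patterns,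 a $\mathcal{P}$-clique is an ordered $r$-matching in which every pair of edges is order-isomorphic to a member of $\mathcal{P}$; $z_{\mathcal{P}}(M)$ is the maximum size of a $\mathcal{P}$-clique that is a sub-matching of $M$. $\mathbb{RM}^{(r)}_n$ is an ordered $r$-matching chosen uniformly at random among all ordered $r$-matchings on $[rn]$. "Asymptotically almost surely" means with probability tending to $1$ as $n\to\infty$. *)

theory Defs
  imports "HOL-Probability.Probability"
begin

definition ordered_matching :: "nat \<Rightarrow> nat \<Rightarrow> 'a::linorder set \<Rightarrow> 'a set set \<Rightarrow> bool" where
  "ordered_matching r n V M \<longleftrightarrow>
     finite V \<and> card V = r * n \<and> finite M \<and> card M = n \<and>
     (\<forall>e\<in>M. e \<subseteq> V \<and> card e = r) \<and> disjoint M"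

definition order_isomorphic ::
  "'a::linorder set \<Rightarrow> 'a set set \<Rightarrow> 'b::linorder set \<Rightarrow> 'b set set \<Rightarrow> bool" where
  "order_isomorphic V E V' E' \<longleftrightarrow>
     (\<exists>f. strict_mono_on V f \<and> f ` V = V' \<and> (\<lambda>e. f ` e) ` E = E')"

datatype letter = LA | LB

fun flip_letter :: "letter \<Rightarrow> letter" where
  "flip_letter LA = LB"
| "flip_letter LB = LA"

text \<open>Words that differ by exchanging the letters represent the same pattern; the normal form
  begins with \<open>LA\<close>.\<close>

definition pattern :: "nat \<Rightarrow> letter list \<Rightarrow> bool" where
  "pattern r w \<longleftrightarrow>
     length w = 2 * r \<and> count_list w LA = r \<and> count_list w LB = r \<and> hd w = LA"

text \<open>The ordered matching of size 2 on \<open>{..<length w}\<close> that a word \<open>w\<close> stands for.\<close>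

definition word_edges :: "letter list \<Rightarrow> nat set set" where
  "word_edges w = {{i. i < length w \<and> w ! i = LA}, {i. i < length w \<and> w ! i = LB}}"

definition block :: "letter list \<Rightarrow> bool" where
  "block S \<longleftrightarrow> (\<exists>k\<ge>1. S = replicate k LA @ replicate k LB \<or> S = replicate k LB @ replicate k LA)"

definition splitting :: "letter list \<Rightarrow> letter list list \<Rightarrow> bool" where
  "splitting P Ss \<longleftrightarrow> concat Ss = P \<and> (\<forall>S\<in>set Ss. block S)"

definition collectable :: "nat \<Rightarrow> letter list \<Rightarrow> bool" where
  "collectable r P \<longleftrightarrow> pattern r P \<and> (\<exists>Ss. splitting P Ss)"

lemma block_append_unique:
  assumes "block S" "block S'" "S @ xs = S' @ ys"
  shows "S = S'"
proof -
  define run :: "letter list \<Rightarrow> nat" where "run w = length (takeWhile (\<lambda>x. x = hd w) w)" for w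
  have run: "S = replicate (run (S @ xs)) (hd (S @ xs)) @ 
      replicate (run (S @ xs)) (flip_letter (hd (S @ xs)))" if S: "block S" for S xs
  proof -
    obtain k a where k: "k \<ge> 1" "S = replicate k a @ replicate k (flip_letter a)"
      using S unfolding block_def by (metis flip_letter.simps)
    have ne: "flip_letter a \<noteq> a" by (cases a) auto
    obtain m where m: "k = Suc m" using k(1) by (cases k) auto
    have hd: "hd (S @ xs) = a" using k(2) m by simp
    have "takeWhile (\<lambda>x. x = a) (replicate k a @ replicate k (flip_letter a) @ xs) = replicate k a"
      using ne by (subst takeWhile_append2) (auto simp: m)
    hence "run (S @ xs) = k" using hd k(2) by (simp add: run_def)
    thus ?thesis using hd k(2) by simp
  qed
  show ?thesis using run[OF assms(1), of xs] run[OF assms(2), of ys] assms(3) by simp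
qed

lemma splitting_unique:
  assumes "splitting P Ss" "splitting P Ss'"
  shows "Ss = Ss'"
  using assms
proof (induction Ss arbitrary: P Ss')
  case Nil
  then show ?case by (cases Ss') (auto simp: splitting_def block_def)
next
  case (Cons S Ss)
  then obtain S' Rs where Ss': "Ss' = S' # Rs"
    by (cases Ss') (auto simp: splitting_def block_def)
  have "S = S'"
    using Cons.prems Ss' block_append_unique[of S S' "concat Ss" "concat Rs"]
    by (auto simp: splitting_def)
  then show ?case
    using Cons.prems Cons.IH[of "concat Ss" Rs] Ss' by (auto simp: splitting_def)
qed

definition blocks :: "letter list \<Rightarrow> letter list list" where
  "blocks P = (THE Ss. splitting P Ss)"

lemma blocks_eq: "splitting P Ss \<Longrightarrow> blocks P = Ss"
  unfolding blocks_def using splitting_unique by blast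

definition composition :: "letter list \<Rightarrow> nat list" where
  "composition P = map (\<lambda>S. length S div 2) (blocks P)"

definition block_partition :: "nat \<Rightarrow> nat \<Rightarrow> (nat \<Rightarrow> nat set) \<Rightarrow> bool" where
  "block_partition s t T \<longleftrightarrow>
     (\<Union>j\<in>{0..t}. T j) = {1..s} \<and> disjoint_family_on T {0..t} \<and>
     (\<forall>j\<in>{0..t}. T j \<noteq> {}) \<and> 1 \<in> T 0"

text \<open>Blocks are numbered from 1 in \<open>T\<close>, whereas list indices start at 0.\<close>

definition flip_pattern :: "letter list \<Rightarrow> (nat \<Rightarrow> nat set) \<Rightarrow> nat set \<Rightarrow> letter list" where
  "flip_pattern P T F = concat (map
     (\<lambda>i. if \<exists>j\<in>F. Suc i \<in> T j then map flip_letter (blocks P ! i) else blocks P ! i)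
     [0..<length (blocks P)])"

definition cube :: "letter list \<Rightarrow> nat \<Rightarrow> (nat \<Rightarrow> nat set) \<Rightarrow> letter list set" where
  "cube P t T = {flip_pattern P T F | F. F \<subseteq> {1..t}}"

text \<open>Both \<open>{e, f}\<close> and \<open>word_edges w\<close> are unordered, so the choice between a word and its
  letter-exchanged version is immaterial here.\<close>

definition pattern_clique :: "nat \<Rightarrow> letter list set \<Rightarrow> 'a::linorder set set \<Rightarrow> bool" where
  "pattern_clique r \<P> K \<longleftrightarrow>
     (\<exists>m. ordered_matching r m (\<Union>K) K) \<and>
     (\<forall>e\<in>K. \<forall>f\<in>K. e \<noteq> f \<longrightarrow>
        (\<exists>w\<in>\<P>. order_isomorphic (e \<union> f) {e, f} {..<length w} (word_edges w)))"

definition max_clique :: "nat \<Rightarrow> letter list set \<Rightarrow> 'a::linorder set set \<Rightarrow> nat" where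
  "max_clique r \<P> M = Max {card K | K. K \<subseteq> M \<and> pattern_clique r \<P> K}"

definition matchings :: "nat \<Rightarrow> nat \<Rightarrow> nat set set set" where
  "matchings r n = {M. ordered_matching r n {1..r * n} M}"

definition random_matching :: "nat \<Rightarrow> nat \<Rightarrow> nat set set pmf" where
  "random_matching r n = pmf_of_set (matchings r n)"

text \<open>\<open>pmf_of_set\<close> is unspecified unless its argument is finite and nonempty.\<close>

lemma finite_matchings: "finite (matchings r n)"
  by (rule finite_subset[of _ "Pow (Pow {1..r * n})"])
     (auto simp: matchings_def ordered_matching_def)

lemma matchings_nonempty:
  assumes "r \<ge> 1"
  shows "matchings r n \<noteq> {}"
proof -
  define E where "E i = {r * i + 1..r * i + r}" for i :: nat
  have card: "card (E i) = r" for i by (simp add: E_def)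
  have less: "x < y" if "i < j" "x \<in> E i" "y \<in> E j" for i j x y
  proof -
    have "r * Suc i \<le> r * j" using that(1) by (intro mult_le_mono2) simp
    thus ?thesis using that by (simp add: E_def)
  qed
  have disj: "E i \<inter> E j = {}" if "i \<noteq> j" for i j
    using less[of i j] less[of j i] that by (metis disjoint_iff less_irrefl linorder_neqE_nat)
  have ne: "E i \<noteq> {}" for i using assms card[of i] by fastforce
  have inj: "inj_on E {..<n}" using disj ne by (metis Int_absorb inj_onI)
  have sub: "E i \<subseteq> {1..r * n}" if "i < n" for i
  proof -
    have "r * Suc i \<le> r * n" using that by (intro mult_le_mono2) simp
    thus ?thesis by (auto simp: E_def)
  qed
  have "disjoint (E ` {..<n})"
    unfolding pairwise_def disjnt_def using disj by (metis imageE)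
  hence "ordered_matching r n {1..r * n} (E ` {..<n})"
    using sub card inj by (auto simp: ordered_matching_def card_image)
  thus ?thesis by (auto simp: matchings_def)
qed

end

theory Submission imports Defs begin

text \<open>
  Upper bound: a clique of size \<open>k\<close> is determined by its vertex set together with the ranks of its
  edges in the mega-blocks, so there are at most \<open>binomial (rn) (rk) * k ^ (tk)\<close> of them in \<open>[rn]\<close>, and
  the expected number contained in a random matching is at most \<open>(C n / k ^ (r - t)) ^ k\<close>.

  Lower bound: cut \<open>[rn]\<close> into \<open>s\<close> consecutive rows of \<open>N\<close> boxes each, with \<open>N\<close> a small multiple of
  \<open>n powr (1 / (r - t))\<close>. An edge whose vertices in all rows of mega-block \<open>j\<close> lie in the box number
  \<open>a j\<close> has type \<open>(a 0, \<dots>, a t)\<close>, and edges whose types differ in every coordinate form a clique. If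
  a maximal such set of edges has size at most \<open>N / 4\<close>, then the matching has no edge of a type avoiding
  the used coordinates. For fixed sets of used coordinates, exposing the matching edge by edge bounds the
  probability of this by \<open>exp (- K N)\<close> with \<open>K\<close> as large as desired, which beats the
  \<open>2 ^ (N (t + 1))\<close> choices of these sets.
\<close>

section \<open>Matchings avoiding or containing given edges\<close>

text \<open>Each mega-block orders the two edges of a pair, and the mega-blocks whose order
  disagrees with that of \<open>T 0\<close> form the flipped set. Exchanging the two letters does
  not change a pattern, so \<open>T 0\<close> can stay unflipped while every combination of orders
  on the mega-blocks still gives a member of the cube. Hence types that differ in every coordinate
  suffice for the lower bound, and in the upper bound the order on \<open>T 0\<close> merely labels
  the edges, which leaves \<open>t\<close> orders to choose.

  The size of \<open>N\<close> comes from a heuristic count. A random edge has a given type with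
  probability of order \<open>1 / N ^ r\<close>, and there are \<open>N ^ (t + 1)\<close> types, so
  about \<open>N * (n / N ^ (r - t))\<close> edges have some type. A small \<open>N\<close> makes
  the second factor large, and this factor is the source of \<open>K\<close>. The obstacles are that
  the used coordinates depend on the matching and that its edges are not independent. A union bound
  over all possible coordinate sets removes the first. For the second, only a small fraction of the
  edges is exposed, so that few boxes can lose half of their vertices.\<close>

definition avoiding :: "nat \<Rightarrow> 'a set set \<Rightarrow> 'a set \<Rightarrow> 'a set set set" where
  "avoiding r G V = {M. \<Union>M = V \<and> disjoint M \<and> (\<forall>e\<in>M. card e = r) \<and> M \<inter> G = {}}"

lemma finite_avoiding: "finite V \<Longrightarrow> finite (avoiding r G V)"
  by (rule finite_subset[of _ "Pow (Pow V)"]) (auto simp: avoiding_def)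

lemma card_Union_uniform:
  assumes "disjoint M" "\<And>e. e \<in> M \<Longrightarrow> card e = r" "r \<ge> 1"
  shows "card (\<Union>M) = r * card M"
proof -
  have "card (\<Union>M) = sum card M"
    using assms by (intro card_Union_disjoint) (auto intro: card_ge_0_finite)
  also have "\<dots> = r * card M" using assms(2) by simp
  finally show ?thesis .
qed

lemma card_avoiding_mem:
  assumes "M \<in> avoiding r G V" "card V = r * n" "r \<ge> 1"
  shows "card M = n"
  using card_Union_uniform[of M r] assms by (auto simp: avoiding_def)

text \<open>Disjoint \<open>r\<close>-sets on \<open>r * n\<close> vertices number \<open>n\<close>
  exactly when they cover everything. Replacing the count by covering allows arbitrary vertex sets,
  as needed when edges are removed one by one.\<close>

lemma matchings_eq_avoiding:
  assumes "r \<ge> 1"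
  shows "matchings r n = avoiding r {} {1..r * n}"
proof (intro equalityI subsetI)
  fix M assume "M \<in> matchings r n"
  then have M: "finite M" "card M = n" "\<forall>e\<in>M. e \<subseteq> {1..r * n} \<and> card e = r" "disjoint M"
    by (auto simp: matchings_def ordered_matching_def)
  have "card (\<Union>M) = r * n" using card_Union_uniform[of M r] M assms by auto
  then have "\<Union>M = {1..r * n}" using M by (intro card_subset_eq) auto
  then show "M \<in> avoiding r {} {1..r * n}" using M by (auto simp: avoiding_def)
next
  fix M assume M: "M \<in> avoiding r {} {1..r * n}"
  then have "M \<subseteq> Pow {1..r * n}" by (auto simp: avoiding_def)
  then have "finite M" by (rule finite_subset) auto
  then show "M \<in> matchings r n" using M card_avoiding_mem[OF M] assms
    by (auto simp: matchings_def ordered_matching_def avoiding_def)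
qed

text \<open>Both sides count the pairs of a matching and one of its edges.\<close>

lemma avoiding_rec:
  assumes V: "finite V" "card V = r * n" and r: "r \<ge> 1"
  shows "n * card (avoiding r G V) =
    (\<Sum>e | e \<subseteq> V \<and> card e = r \<and> e \<notin> G. card (avoiding r G (V - e)))"
proof -
  let ?E = "{e. e \<subseteq> V \<and> card e = r \<and> e \<notin> G}"
  have fE: "finite ?E" using V by (auto intro: finite_subset[of _ "Pow V"])
  have finM: "finite M" if "M \<in> avoiding r G V" for M
    using that V(1) by (intro finite_subset[of M "Pow V"]) (auto simp: avoiding_def)
  have "n * card (avoiding r G V) = (\<Sum>M\<in>avoiding r G V. card M)"
    using card_avoiding_mem[OF _ V(2) r] by simp
  also have "\<dots> = card (SIGMA M:avoiding r G V. M)"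
    using finM finite_avoiding[OF V(1)] by simp
  also have "\<dots> = card (SIGMA e:?E. avoiding r G (V - e))"
  proof (rule bij_betw_same_card, rule bij_betw_byWitness)
    show "\<forall>a\<in>SIGMA M:avoiding r G V. M.
        (\<lambda>(e, M). (insert e M, e)) ((\<lambda>(M, e). (e, M - {e})) a) = a"
      by auto
    have nin: "e \<notin> M" if "card e = r" "M \<in> avoiding r G (V - e)" for e M
    proof
      assume "e \<in> M"
      then have "e \<subseteq> V - e" using that by (auto simp: avoiding_def)
      then have "e = {}" by auto
      then show False using that r by simp
    qed
    then show "\<forall>a\<in>SIGMA e:?E. avoiding r G (V - e).
        (\<lambda>(M, e). (e, M - {e})) ((\<lambda>(e, M). (insert e M, e)) a) = a"
      by auto
    show "(\<lambda>(M, e). (e, M - {e})) ` (SIGMA M:avoiding r G V. M)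
        \<subseteq> (SIGMA e:?E. avoiding r G (V - e))"
    proof (clarify, rule, rule)
      fix M e assume M: "M \<in> avoiding r G V" "e \<in> M"
      then show "e \<subseteq> V \<and> card e = r \<and> e \<notin> G" by (auto simp: avoiding_def)
      have "\<Union>(M - {e}) = V - e"
        using M by (auto simp: avoiding_def pairwise_def disjnt_def)
      then show "M - {e} \<in> avoiding r G (V - e)"
        using M by (auto simp: avoiding_def pairwise_def)
    qed
    show "(\<lambda>(e, M). (insert e M, e)) ` (SIGMA e:?E. avoiding r G (V - e))
        \<subseteq> (SIGMA M:avoiding r G V. M)"
    proof -
      have "insert e M \<in> avoiding r G V"
        if e: "e \<subseteq> V" "card e = r" "e \<notin> G" "M \<in> avoiding r G (V - e)" for e M
      proof -
        have "disjnt e f" if "f \<in> M" for f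
          using that e by (auto simp: avoiding_def disjnt_def)
        then show ?thesis
          using e by (auto simp: avoiding_def pairwise_insert disjnt_sym)
      qed
      then show ?thesis by auto
    qed
  qed
  also have "\<dots> = (\<Sum>e\<in>?E. card (avoiding r G (V - e)))"
    using V(1) by (intro card_SigmaI fE) (auto intro: finite_avoiding)
  finally show ?thesis .
qed

text \<open>The number of \<open>r\<close>-matchings on \<open>r * n\<close> vertices: permutations
  of the vertices modulo the order inside the edges and the order of the edges.\<close>

definition mcount :: "nat \<Rightarrow> nat \<Rightarrow> real" where
  "mcount r n = fact (r * n) / (fact r ^ n * fact n)"

lemma mcount_pos: "mcount r n > 0"
  by (simp add: mcount_def)

lemma mcount_Suc: "real (Suc n) * mcount r (Suc n) = real (r * Suc n choose r) * mcount r n"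
proof -
  have *: "real (r * Suc n choose r) = fact (r * Suc n) / (fact r * fact (r * n))"
    by (subst binomial_fact) auto
  show ?thesis
    unfolding * by (simp add: mcount_def divide_simps del: mult_Suc_right of_nat_Suc)
qed

lemma card_edges_diff:
  assumes "finite V" "e \<subseteq> V" "card e = r" "card V = r * Suc n"
  shows "card (V - e) = r * n"
  using assms by (simp add: card_Diff_subset finite_subset)

lemma card_avoiding_empty:
  assumes "finite V" "card V = r * n" "r \<ge> 1"
  shows "real (card (avoiding r {} V)) = mcount r n"
  using assms(1,2)
proof (induction n arbitrary: V)
  case 0
  then have "avoiding r {} V \<subseteq> {{}}"
    using assms(3) by (fastforce simp: avoiding_def)
  moreover have "{} \<in> avoiding r {} V" using 0 by (simp add: avoiding_def)
  ultimately have "avoiding r {} V = {{}}" by auto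
  then show ?case by (simp add: mcount_def)
next
  case (Suc n)
  let ?E = "{e. e \<subseteq> V \<and> card e = r}"
  have "Suc n * card (avoiding r {} V) = (\<Sum>e\<in>?E. card (avoiding r {} (V - e)))"
    using avoiding_rec[OF Suc.prems assms(3), of "{}"] by simp
  then have "real (Suc n) * real (card (avoiding r {} V)) =
      (\<Sum>e\<in>?E. real (card (avoiding r {} (V - e))))"
    by (simp only: flip: of_nat_mult of_nat_sum)
  also have "\<dots> = (\<Sum>e\<in>?E. mcount r n)"
    using Suc card_edges_diff[of V _ r n] by (intro sum.cong refl) auto
  also have "\<dots> = real (Suc n) * mcount r (Suc n)"
    using n_subsets[OF Suc.prems(1), of r] Suc.prems(2) by (simp only: mcount_Suc) simp
  finally show ?case by (simp del: of_nat_Suc)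
qed

text \<open>Exposing a uniformly random edge \<open>J\<close> times, each exposed edge lies in \<open>G\<close> with conditional
  probability at least \<open>p\<close>.\<close>

lemma card_avoiding_le:
  assumes "finite V" "card V = r * n" "r \<ge> 1" "J \<le> n" "0 \<le> p" "p \<le> 1"
    and "\<And>W. W \<subseteq> V \<Longrightarrow> r * (n - J) \<le> card W \<Longrightarrow>
      p * real (card W choose r) \<le> real (card {e\<in>G. e \<subseteq> W \<and> card e = r})"
  shows "real (card (avoiding r G V)) \<le> (1 - p) ^ J * mcount r n"
  using assms(1,2,4,7)
proof (induction J arbitrary: V n)
  case 0
  have "card (avoiding r G V) \<le> card (avoiding r {} V)"
    using 0 by (intro card_mono finite_avoiding) (auto simp: avoiding_def)
  then show ?case using card_avoiding_empty[OF 0(1,2) assms(3)] by simp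
next
  case (Suc J)
  then obtain m where n: "n = Suc m" by (cases n) auto
  let ?A = "{e. e \<subseteq> V \<and> card e = r}" and ?B = "{e\<in>G. e \<subseteq> V \<and> card e = r}"
  let ?E = "{e. e \<subseteq> V \<and> card e = r \<and> e \<notin> G}"
  have fA: "finite ?A" using Suc.prems(1) by (auto intro: finite_subset[of _ "Pow V"])
  have q: "0 \<le> (1 - p) ^ J * mcount r m" using mcount_pos[of r m] assms(6) by simp
  have "n * card (avoiding r G V) = (\<Sum>e\<in>?E. card (avoiding r G (V - e)))"
    using avoiding_rec[OF Suc.prems(1,2) assms(3), of G] .
  then have "real n * real (card (avoiding r G V)) =
      (\<Sum>e\<in>?E. real (card (avoiding r G (V - e))))"
    by (simp only: flip: of_nat_mult of_nat_sum)
  \<comment> \<open>Since \<open>n - Suc J = m - J\<close>, the density hypothesis on subsets of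
    \<open>V\<close> passes to subsets of \<open>V - e\<close>.\<close>
  also have "\<dots> \<le> (\<Sum>e\<in>?E. (1 - p) ^ J * mcount r m)"
    using Suc.prems card_edges_diff[of V _ r m] n
    by (intro sum_mono Suc.IH) auto
  also have "\<dots> = real (card ?E) * ((1 - p) ^ J * mcount r m)" by simp
  also have "?E = ?A - ?B" by auto
  also have "card (?A - ?B) = card ?A - card ?B"
    using fA by (intro card_Diff_subset) (auto intro: finite_subset[of _ ?A])
  also have "real \<dots> = real (card ?A) - real (card ?B)"
    using fA by (intro of_nat_diff card_mono) auto
  also have "real (card ?A) = real (card V choose r)"
    using n_subsets[OF Suc.prems(1), of r] by simp
  also have "(real (card V choose r) - real (card ?B)) * ((1 - p) ^ J * mcount r m) \<le>
      ((1 - p) * real (card V choose r)) * ((1 - p) ^ J * mcount r m)"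
    using Suc.prems(4)[of V] Suc.prems(2) by (intro mult_right_mono q) (simp add: algebra_simps)
  also have "\<dots> = (1 - p) ^ Suc J * (real (r * Suc m choose r) * mcount r m)"
    using Suc.prems(2) n by (simp add: algebra_simps)
  also have "\<dots> = real n * ((1 - p) ^ Suc J * mcount r n)"
    by (simp only: mcount_Suc[symmetric] n mult.left_commute)
  finally show ?case by (rule mult_left_le_imp_le) (simp add: n)
qed

text \<open>Deleting \<open>K\<close> is injective on the matchings that contain it and leaves a
  matching of the remaining vertices.\<close>

lemma card_matchings_containing_le:
  assumes "finite V" "card V = r * n" "r \<ge> 1" "disjoint K" "\<And>e. e \<in> K \<Longrightarrow> card e = r" "\<Union>K \<subseteq> V"
  shows "real (card {M\<in>avoiding r {} V. K \<subseteq> M}) \<le> mcount r (n - card K)"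
proof -
  have UK: "card (\<Union>K) = r * card K" using assms by (intro card_Union_uniform) auto
  then have "r * card K \<le> r * n" using assms(1,2,6) card_mono by metis
  have "card {M\<in>avoiding r {} V. K \<subseteq> M} \<le> card (avoiding r {} (V - \<Union>K))"
  proof (rule card_inj_on_le)
    show "inj_on (\<lambda>M. M - K) {M\<in>avoiding r {} V. K \<subseteq> M}" by (auto simp: inj_on_def)
    show "(\<lambda>M. M - K) ` {M\<in>avoiding r {} V. K \<subseteq> M} \<subseteq> avoiding r {} (V - \<Union>K)"
    proof clarify
      fix M assume M: "M \<in> avoiding r {} V" "K \<subseteq> M"
      then have "\<Union>(M - K) = V - \<Union>K"
        by (fastforce simp: avoiding_def pairwise_def disjnt_def)
      then show "M - K \<in> avoiding r {} (V - \<Union>K)"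
        using M by (auto simp: avoiding_def pairwise_def)
    qed
  qed (use assms(1) in \<open>auto intro: finite_avoiding\<close>)
  moreover have "card (V - \<Union>K) = r * (n - card K)"
    using assms UK by (simp add: card_Diff_subset finite_subset diff_mult_distrib2)
  ultimately show ?thesis
    using card_avoiding_empty[of "V - \<Union>K" r "n - card K"] assms by simp
qed

section \<open>Pairs of edges and collectable words\<close>

text \<open>The point \<open>x\<close> may lie outside \<open>A\<close>. This makes
  \<open>idx\<close> additive over disjoint sets, so that the position of a vertex in a union can be
  computed edge by edge.\<close>

definition idx :: "'a::linorder set \<Rightarrow> 'a \<Rightarrow> nat" where
  "idx A x = card {y\<in>A. y < x}"

text \<open>\<open>R\<close> sees only the indices inside the two sets. It therefore records how
  \<open>X\<close> and \<open>Y\<close> interleave, independently of the ground set, and can be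
  shared by a pair of edges and a word.\<close>

definition separated :: "(nat \<Rightarrow> nat \<Rightarrow> bool) \<Rightarrow> 'a::linorder set \<Rightarrow> 'a set \<Rightarrow> bool" where
  "separated R X Y \<longleftrightarrow> (\<forall>x\<in>X. \<forall>y\<in>Y. x < y \<longleftrightarrow> R (idx X x) (idx Y y))"

lemma idx_strict_mono: "finite A \<Longrightarrow> x \<in> A \<Longrightarrow> x < y \<Longrightarrow> idx A x < idx A y"
  unfolding idx_def by (rule psubset_card_mono) auto

lemma bij_betw_idx:
  assumes "finite A"
  shows "bij_betw (idx A) A {..<card A}"
proof -
  have inj: "inj_on (idx A) A"
    using idx_strict_mono[OF assms] by (metis inj_onI less_irrefl linorder_neqE)
  have "idx A x < card A" if "x \<in> A" for x
    unfolding idx_def using assms that by (intro psubset_card_mono) auto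
  then have "idx A ` A = {..<card A}"
    using inj by (intro card_subset_eq) (auto simp: card_image)
  then show ?thesis using inj by (simp add: bij_betw_def)
qed

lemma idx_lessThan: "a < m \<Longrightarrow> idx {..<m} a = (a::nat)"
proof -
  assume "a < m"
  then have "{y\<in>{..<m}. y < a} = {..<a}" by auto
  then show ?thesis by (simp add: idx_def)
qed

lemma idx_Un:
  assumes "finite X" "finite Y" "X \<inter> Y = {}"
  shows "idx (X \<union> Y) x = idx X x + idx Y x"
proof -
  have "{y\<in>X \<union> Y. y < x} = {y\<in>X. y < x} \<union> {y\<in>Y. y < x}" by auto
  then show ?thesis unfolding idx_def using assms by (simp add: card_Un_disjoint disjoint_iff)
qed

lemma idx_image:
  assumes "strict_mono_on B \<phi>" "A \<subseteq> B" "x \<in> B"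
  shows "idx (\<phi> ` A) (\<phi> x) = idx A x"
proof -
  have "\<phi> y < \<phi> x \<longleftrightarrow> y < x" if "y \<in> A" for y
    using strict_mono_on_less[OF assms(1), of y x] assms that by auto
  then have "{z\<in>\<phi> ` A. z < \<phi> x} = \<phi> ` {y\<in>A. y < x}" by auto
  moreover have "inj_on \<phi> {y\<in>A. y < x}"
    using strict_mono_on_imp_inj_on[OF assms(1)] assms(2) by (auto intro: inj_on_subset)
  ultimately show ?thesis by (simp add: idx_def card_image)
qed

lemma separated_image:
  assumes "strict_mono_on (X \<union> Y) \<phi>"
  shows "separated R (\<phi> ` X) (\<phi> ` Y) \<longleftrightarrow> separated R X Y"
proof -
  have "\<phi> x < \<phi> y \<longleftrightarrow> x < y" if "x \<in> X" "y \<in> Y" for x y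
    using strict_mono_on_less[OF assms, of x y] that by auto
  then show ?thesis
    unfolding separated_def using idx_image[OF assms] by auto
qed

text \<open>The index of a vertex in the union is its index in its own edge plus the number of
  vertices of the other edge to its left, and \<open>R\<close> determines the latter. So both images
  depend on \<open>R\<close> and \<open>r\<close> alone.\<close>

lemma idx_image_separated:
  assumes fin: "finite X" "finite Y" and disj: "X \<inter> Y = {}" and r: "card X = r" "card Y = r"
    and sep: "separated R X Y"
  shows "idx (X \<union> Y) ` X = (\<lambda>p. p + card {q. q < r \<and> \<not> R p q}) ` {..<r}" (is ?X)
    and "idx (X \<union> Y) ` Y = (\<lambda>q. q + card {p. p < r \<and> R p q}) ` {..<r}" (is ?Y)
proof -
  note bX = bij_betw_idx[OF fin(1), unfolded r] and bY = bij_betw_idx[OF fin(2), unfolded r]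
  have 1: "idx (X \<union> Y) x = idx X x + card {q. q < r \<and> \<not> R (idx X x) q}" if "x \<in> X" for x
  proof -
    have "y < x \<longleftrightarrow> \<not> R (idx X x) (idx Y y)" if "y \<in> Y" for y
      using sep that \<open>x \<in> X\<close> disj unfolding separated_def
      by (metis disjoint_iff linorder_neqE order_less_asym)
    then have "idx Y ` {y\<in>Y. y < x} = {q\<in>idx Y ` Y. \<not> R (idx X x) q}" by auto
    then have "idx Y ` {y\<in>Y. y < x} = {q. q < r \<and> \<not> R (idx X x) q}"
      using bY by (auto simp: bij_betw_def)
    moreover have "card (idx Y ` {y\<in>Y. y < x}) = idx Y x"
      unfolding idx_def[of Y x] using bY
      by (intro card_image) (auto simp: bij_betw_def intro: inj_on_subset)
    ultimately show ?thesis using idx_Un[OF fin disj] by simp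
  qed
  have 2: "idx (X \<union> Y) y = idx Y y + card {p. p < r \<and> R p (idx Y y)}" if "y \<in> Y" for y
  proof -
    have "idx X ` {x\<in>X. x < y} = {p\<in>idx X ` X. R p (idx Y y)}"
      using sep that unfolding separated_def by auto
    then have "idx X ` {x\<in>X. x < y} = {p. p < r \<and> R p (idx Y y)}"
      using bX by (auto simp: bij_betw_def)
    moreover have "card (idx X ` {x\<in>X. x < y}) = idx X y"
      unfolding idx_def[of X y] using bX
      by (intro card_image) (auto simp: bij_betw_def intro: inj_on_subset)
    ultimately show ?thesis using idx_Un[OF fin disj] by simp
  qed
  have "idx (X \<union> Y) ` X = (\<lambda>p. p + card {q. q < r \<and> \<not> R p q}) ` idx X ` X"
    unfolding image_image using 1 by (intro image_cong) auto
  then show ?X using bX by (simp add: bij_betw_def)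
  have "idx (X \<union> Y) ` Y = (\<lambda>q. q + card {p. p < r \<and> R p q}) ` idx Y ` Y"
    unfolding image_image using 2 by (intro image_cong) auto
  then show ?Y using bY by (simp add: bij_betw_def)
qed

abbreviation positions :: "letter list \<Rightarrow> letter \<Rightarrow> nat set" where
  "positions w c \<equiv> {i. i < length w \<and> w ! i = c}"

lemma positions_Un: "positions w LA \<union> positions w LB = {..<length w}"
proof -
  have "w ! i = LA \<or> w ! i = LB" for i by (cases "w ! i") auto
  then show ?thesis by auto
qed

text \<open>An order isomorphism preserves interleaving. Conversely, \<open>idx\<close> on the union
  is itself the isomorphism, since it sends edges with the interleaving \<open>R\<close> to the sets
  prescribed by \<open>R\<close>. The disjunction appears because either edge may take the letter
  \<open>LA\<close>.\<close>

lemma order_isomorphic_word_iff: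
  assumes fin: "finite e" "finite f" and disj: "e \<inter> f = {}" and r: "card e = r" "card f = r"
    and w: "card (positions w LA) = r" "card (positions w LB) = r"
    and sep: "separated R (positions w LA) (positions w LB)"
  shows "order_isomorphic (e \<union> f) {e, f} {..<length w} (word_edges w) \<longleftrightarrow>
    separated R e f \<or> separated R f e"
proof
  assume "order_isomorphic (e \<union> f) {e, f} {..<length w} (word_edges w)"
  then obtain \<phi> where \<phi>: "strict_mono_on (e \<union> f) \<phi>"
    "{\<phi> ` e, \<phi> ` f} = {positions w LA, positions w LB}"
    unfolding order_isomorphic_def word_edges_def by auto
  then consider "\<phi> ` e = positions w LA" "\<phi> ` f = positions w LB" |
      "\<phi> ` f = positions w LA" "\<phi> ` e = positions w LB"
    by (auto simp: doubleton_eq_iff)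
  then show "separated R e f \<or> separated R f e"
    using separated_image[OF \<phi>(1)] \<phi>(1) separated_image[of f e \<phi>] sep
    by cases (auto simp: Un_commute)
next
  have *: "order_isomorphic (e \<union> f) {e, f} {..<length w} (word_edges w)"
    if "finite e" "finite f" "e \<inter> f = {}" "card e = r" "card f = r" "separated R e f" for e f :: "'a set"
  proof -
    let ?A = "positions w LA" and ?B = "positions w LB"
    have AB: "finite ?A" "finite ?B" "?A \<inter> ?B = {}" by auto
    then have len: "length w = 2 * r"
      using w positions_Un[of w] card_Un_disjoint[of ?A ?B] by simp
    have "card (e \<union> f) = length w" using that len by (simp add: card_Un_disjoint)
    then have b: "bij_betw (idx (e \<union> f)) (e \<union> f) {..<length w}"
      using bij_betw_idx[of "e \<union> f"] that by simp
    \<comment> \<open>The positions of a word form an initial segment of the naturals, on which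
      \<open>idx\<close> is the identity.\<close>
    have id: "idx (?A \<union> ?B) ` S = S" if "S \<subseteq> {..<length w}" for S
      unfolding positions_Un using that idx_lessThan[of _ "length w"] by (force simp: image_iff)
    have "idx (e \<union> f) ` e = idx (?A \<union> ?B) ` ?A" "idx (e \<union> f) ` f = idx (?A \<union> ?B) ` ?B"
      by (simp_all only: idx_image_separated[OF that] idx_image_separated[OF AB w sep])
    then have "idx (e \<union> f) ` e = ?A" "idx (e \<union> f) ` f = ?B"
      using id[of ?A] id[of ?B] by auto
    moreover have "strict_mono_on (e \<union> f) (idx (e \<union> f))"
      using that by (auto intro!: strict_mono_onI idx_strict_mono)
    ultimately show ?thesis
      using b unfolding order_isomorphic_def word_edges_def bij_betw_def
      by (intro exI[of _ "idx (e \<union> f)"]) simp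
  qed
  assume "separated R e f \<or> separated R f e"
  then show "order_isomorphic (e \<union> f) {e, f} {..<length w} (word_edges w)"
    using *[of e f] *[of f e] assms by (auto simp: Un_commute insert_commute)
qed

text \<open>For a composition \<open>ls\<close>, the number of the part that contains
  \<open>p\<close>. Arguments past the end receive \<open>length ls\<close>, which keeps the
  function monotone on all naturals. It is applied to the index of an occurrence among the
  occurrences of one letter, as a block contributes equally many of both letters.\<close>

fun blk :: "nat list \<Rightarrow> nat \<Rightarrow> nat" where
  "blk [] p = 0"
| "blk (l # ls) p = (if p < l then 0 else Suc (blk ls (p - l)))"

lemma blk_mono: "p \<le> q \<Longrightarrow> blk ls p \<le> blk ls q"
  by (induction ls arbitrary: p q) auto

lemma blk_less: "p < sum_list ls \<Longrightarrow> blk ls p < length ls"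
  by (induction ls arbitrary: p) auto

lemma blk_surj:
  assumes "\<forall>l\<in>set ls. l \<ge> 1" "i < length ls"
  shows "\<exists>p<sum_list ls. blk ls p = i"
  using assms
proof (induction ls arbitrary: i)
  case (Cons l ls)
  show ?case
  proof (cases i)
    case 0
    then show ?thesis using Cons.prems by (intro exI[of _ 0]) auto
  next
    case (Suc j)
    then obtain p where "p < sum_list ls" "blk ls p = j" using Cons by auto
    then show ?thesis using Suc by (intro exI[of _ "l + p"]) auto
  qed
qed simp

section \<open>Order of the letter occurrences in a concatenation of blocks\<close>

lemma idx_positions: "a \<le> length w \<Longrightarrow> idx (positions w c) a = count_list (take a w) c"
proof (induction a)
  case (Suc a)
  have "{y\<in>positions w c. y < Suc a} =
      (if w ! a = c then insert a {y\<in>positions w c. y < a} else {y\<in>positions w c. y < a})"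
    using Suc.prems by (auto simp: less_Suc_eq)
  then show ?case using Suc by (simp add: idx_def take_Suc_conv_app_nth)
qed (simp add: idx_def)

lemma card_positions: "card (positions w c) = count_list w c"
proof -
  have "{y\<in>positions w c. y < length w} = positions w c" by auto
  then show ?thesis using idx_positions[of "length w" w c] by (simp add: idx_def)
qed

lemma flip_letter_neq [simp]: "flip_letter c \<noteq> c" "c \<noteq> flip_letter c"
  by (cases c; simp)+

lemma blockE:
  assumes "block S"
  obtains l c where "l \<ge> 1" "S = replicate l c @ replicate l (flip_letter c)"
  using assms unfolding block_def by (metis flip_letter.simps)

lemma count_list_replicate': "count_list (replicate n x) y = (if x = y then n else 0)"
  by (induction n) auto

lemma count_block: "count_list (replicate l c @ replicate l (flip_letter c)) b = l"
  by (cases b; cases c) (simp_all add: count_list_replicate')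

lemma count_concat_blocks:
  "\<forall>S\<in>set Ss. block S \<Longrightarrow> count_list (concat Ss) b = sum_list (map (\<lambda>S. length S div 2) Ss)"
proof (induction Ss)
  case (Cons S Ss)
  then obtain l c where "S = replicate l c @ replicate l (flip_letter c)"
    by (auto elim: blockE)
  then have "count_list S b = length S div 2" using count_block[of l c b] by simp
  then show ?case using Cons by simp
qed simp

text \<open>Occurrences in different blocks are ordered as the blocks are, and inside one block all
  occurrences of its first letter come before those of the other. The induction splits off the first
  block.\<close>

lemma less_concat_blocks_iff:
  assumes "\<forall>S\<in>set Ss. block S" "w = concat Ss" "ls = map (\<lambda>S. length S div 2) Ss"
    and "a < length w" "b < length w" "w ! a = LA" "w ! b = LB"
    and "i = blk ls (count_list (take a w) LA)" "j = blk ls (count_list (take b w) LB)"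
  shows "a < b \<longleftrightarrow> i < j \<or> i = j \<and> hd (Ss ! i) = LA"
  using assms
proof (induction Ss arbitrary: w ls a b i j)
  case (Cons S Ss)
  obtain l c where S: "l \<ge> 1" "S = replicate l c @ replicate l (flip_letter c)"
    using Cons.prems(1) by (auto elim: blockE)
  have w: "w = S @ concat Ss" using Cons.prems(2) by simp
  have lenS: "length S = 2 * l" using S by simp
  let ?ls = "map (\<lambda>S. length S div 2) Ss"
  have ls: "ls = l # ?ls" using Cons.prems(3) lenS by simp
  have hdS: "hd S = c" using S by (cases l) auto
  \<comment> \<open>A position inside the first block: the letter there tells in which half of the
    block it lies.\<close>
  have lo: "count_list (take x w) b < l" "x < l \<longleftrightarrow> c = b" if "x < 2 * l" "w ! x = b" for x b
  proof -
    have x: "S ! x = b" using that lenS w by (simp add: nth_append)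
    show "x < l \<longleftrightarrow> c = b"
      using x that(1) by (cases "x < l") (auto simp: S(2) nth_append)
    then show "count_list (take x w) b < l"
      using x S that(1) w by (auto simp: count_list_replicate' min_def nth_append)
  qed
  have cS: "count_list S b = l" for b using count_block[of l c b] S(2) by simp
  \<comment> \<open>A position after the first block: that block has contributed \<open>l\<close>
    occurrences of either letter.\<close>
  have hi: "count_list (take x w) b = l + count_list (take (x - 2 * l) (concat Ss)) b"
    "w ! x = concat Ss ! (x - 2 * l)" if "\<not> x < 2 * l" for x b
    using that w lenS cS by (simp_all add: nth_append)
  show ?case
  proof (cases "a < 2 * l")
    case True
    note a = this
    have i: "i = 0" using lo[OF a Cons.prems(6)] Cons.prems(8) ls by simp
    show ?thesis
    proof (cases "b < 2 * l")
      case True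
      then have "j = 0" using lo[OF True Cons.prems(7)] Cons.prems(9) ls by simp
      moreover have "a < l \<longleftrightarrow> c = LA" "b < l \<longleftrightarrow> c = LB"
        using lo(2)[OF a Cons.prems(6)] lo(2)[OF True Cons.prems(7)] by auto
      ultimately show ?thesis using i hdS by (cases c) auto
    next
      case False
      then have "j > 0" using hi(1)[OF False] Cons.prems(9) ls by simp
      then show ?thesis using i a False by simp
    qed
  next
    case False
    note a = this
    have i: "i = Suc (blk ?ls (count_list (take (a - 2 * l) (concat Ss)) LA))"
      using hi[OF a] Cons.prems(8) ls by simp
    show ?thesis
    proof (cases "b < 2 * l")
      case True
      then have "j = 0" using lo[OF True Cons.prems(7)] Cons.prems(9) ls by simp
      then show ?thesis using i a True by simp
    next
      case False
      have j: "j = Suc (blk ?ls (count_list (take (b - 2 * l) (concat Ss)) LB))"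
        using hi[OF False] Cons.prems(9) ls by simp
      have "a - 2 * l < b - 2 * l \<longleftrightarrow> i - 1 < j - 1 \<or> i - 1 = j - 1 \<and> hd (Ss ! (i - 1)) = LA"
        using Cons.prems(1,4-7) w lenS a False hi(2) i j by (intro Cons.IH) auto
      then show ?thesis using i j a False by auto
    qed
  qed
qed simp

lemma separated_concat_blocks:
  assumes "\<forall>S\<in>set Ss. block S" "ls = map (\<lambda>S. length S div 2) Ss"
  shows "separated (\<lambda>p q. blk ls p < blk ls q \<or> blk ls p = blk ls q \<and> hd (Ss ! blk ls p) = LA)
    (positions (concat Ss) LA) (positions (concat Ss) LB)"
  unfolding separated_def
  using less_concat_blocks_iff[OF assms(1) refl assms(2) _ _ _ _ refl refl]
  by (auto simp: idx_positions)

section \<open>Counting cliques\<close>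

lemma idx_Union:
  assumes "finite K" "disjoint K" "\<And>e. e \<in> K \<Longrightarrow> finite e"
  shows "idx (\<Union>K) x = (\<Sum>f\<in>K. idx f x)"
proof -
  have "{y\<in>\<Union>K. y < x} = (\<Union>f\<in>K. {y\<in>f. y < x})" by auto
  also have "card \<dots> = (\<Sum>f\<in>K. card {y\<in>f. y < x})"
    using assms by (intro card_UN_disjoint) (auto simp: pairwise_def disjnt_iff)
  finally show ?thesis by (simp add: idx_def)
qed

text \<open>Position \<open>p < r\<close> of an edge belongs to block \<open>bl p\<close>, block \<open>i\<close> to mega-block \<open>mega i\<close>, and
  \<open>up i\<close> says that block \<open>i\<close> of the unflipped pattern is of the form \<open>A\<dots>AB\<dots>B\<close>.\<close>

locale pattern_cube =
  fixes r s t :: nat and bl :: "nat \<Rightarrow> nat" and up :: "nat \<Rightarrow> bool" and mega :: "nat \<Rightarrow> nat"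
  assumes bl_mono: "p \<le> q \<Longrightarrow> bl p \<le> bl q"
    and bl_image: "bl ` {..<r} = {..<s}"
    and mega_image: "mega ` {..<s} = {..t}"
begin

text \<open>The interleaving of the pattern with flipped set \<open>F\<close>: whether occurrence
  \<open>p\<close> of \<open>LA\<close> comes before occurrence \<open>q\<close> of
  \<open>LB\<close>. Membership of the mega-block in \<open>F\<close> reverses the orientation
  \<open>up\<close>.\<close>

definition before :: "nat set \<Rightarrow> nat \<Rightarrow> nat \<Rightarrow> bool" where
  "before F p q \<longleftrightarrow> bl p < bl q \<or> bl p = bl q \<and> (up (bl p) \<longleftrightarrow> mega (bl p) \<notin> F)"

definition compatible :: "'a::linorder set \<Rightarrow> 'a set \<Rightarrow> bool" where
  "compatible e f \<longleftrightarrow> (\<exists>F\<subseteq>{1..t}. separated (before F) e f \<or> separated (before F) f e)"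

definition clique :: "'a::linorder set set \<Rightarrow> bool" where
  "clique K \<longleftrightarrow> finite K \<and> disjoint K \<and> (\<forall>e\<in>K. card e = r) \<and>
     (\<forall>e\<in>K. \<forall>f\<in>K. e \<noteq> f \<longrightarrow> compatible e f)"

text \<open>The order that mega-block \<open>j\<close> puts on the edges: \<open>e\<close> takes the
  letter \<open>LA\<close> once the flip of that mega-block is undone. All blocks of a mega-block
  are flipped together, so one order serves all of them.\<close>

definition precedes :: "nat \<Rightarrow> 'a::linorder set \<Rightarrow> 'a set \<Rightarrow> bool" where
  "precedes j e f \<longleftrightarrow> (\<exists>F\<subseteq>{1..t}. separated (before F) e f \<and> j \<notin> F \<or> separated (before F) f e \<and> j \<in> F)"

definition rank :: "'a::linorder set set \<Rightarrow> nat \<Rightarrow> 'a set \<Rightarrow> nat" where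
  "rank K j e = card {f\<in>K - {e}. precedes j f e}"

definition lower :: "nat \<Rightarrow> nat" where
  "lower i = card {q. q < r \<and> bl q < i}"

definition width :: "nat \<Rightarrow> nat" where
  "width i = card {q. q < r \<and> bl q = i}"

text \<open>The number of vertices of a clique of size \<open>k\<close> to the left of the vertex with index \<open>p\<close> of the
  edge with rank \<open>c\<close> in the mega-block of \<open>p\<close>.\<close>

definition position :: "nat \<Rightarrow> nat \<Rightarrow> nat \<Rightarrow> nat" where
  "position k p c =
     p + (k - 1) * lower (bl p) + width (bl p) * (if up (bl p) then c else k - 1 - c)"

definition edge_of_ranks :: "'a::linorder set \<Rightarrow> nat \<Rightarrow> (nat \<Rightarrow> nat) \<Rightarrow> 'a set" where
  "edge_of_ranks V k c = {x\<in>V. idx V x \<in> (\<lambda>p. position k p (c (mega (bl p)))) ` {..<r}}"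

lemma r_pos: "r \<ge> 1"
proof -
  have "{..t} \<noteq> {}" by auto
  then show ?thesis using bl_image mega_image by (cases r) auto
qed

lemma s_le_r: "s \<le> r"
  using card_image_le[of "{..<r}" bl] by (simp add: bl_image)

lemma t_less_s: "t < s"
  using card_image_le[of "{..<s}" mega] by (simp add: mega_image)

lemma bl_less: "p < r \<Longrightarrow> bl p < s"
  using bl_image by auto

lemma mega_le: "i < s \<Longrightarrow> mega i \<le> t"
  using mega_image by auto

lemma mega_bl_surj:
  assumes "j \<le> t"
  obtains p where "p < r" "mega (bl p) = j"
proof -
  have "j \<in> mega ` bl ` {..<r}" using assms by (simp add: bl_image mega_image)
  then show ?thesis using that by auto
qed

lemma clique_finite_mem: "clique K \<Longrightarrow> e \<in> K \<Longrightarrow> finite e"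
  using r_pos unfolding clique_def by (metis card_ge_0_finite less_le_trans zero_less_one)

lemma compatible_sym: "compatible e f \<longleftrightarrow> compatible f e"
  unfolding compatible_def by blast

lemma compatible_less:
  assumes "compatible e f" "e \<inter> f = {}" "x \<in> e" "y \<in> f" "bl (idx e x) < bl (idx f y)"
  shows "x < y"
  using assms unfolding compatible_def separated_def before_def
  by (metis disjoint_iff less_asym less_irrefl linorder_neqE)

lemma precedes_less_iff:
  assumes "precedes (mega i) e f" "e \<inter> f = {}" "x \<in> e" "y \<in> f" "bl (idx e x) = i" "bl (idx f y) = i"
  shows "x < y \<longleftrightarrow> up i"
proof -
  obtain F where "separated (before F) e f \<and> mega i \<notin> F \<or> separated (before F) f e \<and> mega i \<in> F"
    using assms(1) unfolding precedes_def by blast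
  moreover have "x \<noteq> y" using assms by auto
  ultimately show ?thesis
    using assms(3-6) unfolding separated_def before_def by (metis less_asym less_irrefl linorder_neqE)
qed

lemma precedes_total: "compatible e f \<Longrightarrow> precedes j e f \<or> precedes j f e"
  unfolding compatible_def precedes_def by blast

text \<open>Relative to \<open>x\<close>, the earlier blocks of \<open>f\<close> lie to the left and
  the later ones to the right. Block \<open>i\<close> of \<open>f\<close> lies on one side as a
  whole, and \<open>precedes\<close> together with \<open>up i\<close> tells which side.\<close>

lemma idx_other_edge:
  assumes comp: "compatible e f" and disj: "e \<inter> f = {}" and f: "card f = r" and x: "x \<in> e"
    and i: "i = bl (idx e x)"
  shows "idx f x = lower i + (if precedes (mega i) f e = up i then width i else 0)"
proof -
  have "finite f" using f r_pos card_ge_0_finite[of f] by simp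
  then have b: "bij_betw (idx f) f {..<r}" using bij_betw_idx[of f] f by simp
  let ?c = "precedes (mega i) f e = up i"
  have less: "y < x \<longleftrightarrow> bl (idx f y) < i \<or> bl (idx f y) = i \<and> ?c" if y: "y \<in> f" for y
  proof (cases "bl (idx f y)" i rule: linorder_cases)
    case less
    then show ?thesis
      using compatible_less[of f e y x] comp disj y x i compatible_sym by (auto simp: Int_commute)
  next
    case greater
    then have "x < y" using compatible_less[OF comp disj x y] i by auto
    then show ?thesis using greater by auto
  next
    case equal
    have "x \<noteq> y" using disj x y by auto
    moreover have "x < y \<longleftrightarrow> up i" if "precedes (mega i) e f"
      using precedes_less_iff[OF that disj x y i[symmetric] equal] .
    moreover have "y < x \<longleftrightarrow> up i" if "precedes (mega i) f e"
      using precedes_less_iff[OF that _ y x equal i[symmetric]] disj by (simp add: Int_commute)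
    ultimately show ?thesis using precedes_total[OF comp, of "mega i"] equal by auto
  qed
  have "idx f x = card (idx f ` {y\<in>f. y < x})"
    unfolding idx_def[of f x] using b
    by (intro card_image[symmetric]) (auto simp: bij_betw_def intro: inj_on_subset)
  also have "idx f ` {y\<in>f. y < x} = {q\<in>idx f ` f. bl q < i \<or> bl q = i \<and> ?c}"
    using less by auto
  also have "\<dots> = {q. q < r \<and> bl q < i} \<union> (if ?c then {q. q < r \<and> bl q = i} else {})"
    using b by (auto simp: bij_betw_def)
  also have "card \<dots> = lower i + (if ?c then width i else 0)"
    unfolding lower_def width_def by (subst card_Un_disjoint) auto
  finally show ?thesis .
qed

text \<open>By additivity of \<open>idx\<close>, each other edge contributes \<open>lower i\<close>,
  and those whose block \<open>i\<close> lies to the left contribute \<open>width i\<close> more.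
  The number of the latter is the rank if \<open>up i\<close> holds, and its complement in
  \<open>card K - 1\<close> otherwise.\<close>

lemma idx_Union_clique:
  assumes K: "clique K" "e \<in> K" and x: "x \<in> e"
  shows "idx (\<Union>K) x = position (card K) (idx e x) (rank K (mega (bl (idx e x))) e)"
proof -
  define i where "i = bl (idx e x)"
  have fK: "finite K" using K by (simp add: clique_def)
  have other: "idx f x = lower i + (if precedes (mega i) f e = up i then width i else 0)"
    if "f \<in> K - {e}" for f
  proof (rule idx_other_edge[OF _ _ _ x i_def])
    show "compatible e f" "e \<inter> f = {}" "card f = r"
      using that K by (auto simp: clique_def pairwise_def disjnt_def)
  qed
  have c: "card {f\<in>K - {e}. precedes (mega i) f e = up i} =
      (if up i then rank K (mega i) e else card K - 1 - rank K (mega i) e)"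
  proof (cases "up i")
    case False
    have "{f\<in>K - {e}. precedes (mega i) f e = up i} = (K - {e}) - {f\<in>K - {e}. precedes (mega i) f e}"
      using False by auto
    also have "card \<dots> = card (K - {e}) - rank K (mega i) e"
      unfolding rank_def using fK by (intro card_Diff_subset) auto
    finally show ?thesis using False K(2) by simp
  qed (simp add: rank_def)
  have "idx (\<Union>K) x = (\<Sum>f\<in>K. idx f x)"
    using K clique_finite_mem[OF K(1)] by (intro idx_Union) (auto simp: clique_def)
  also have "\<dots> = idx e x + (\<Sum>f\<in>K - {e}. idx f x)"
    using fK K(2) by (simp add: sum.remove)
  also have "(\<Sum>f\<in>K - {e}. idx f x) =
      (\<Sum>f\<in>K - {e}. lower i + (if precedes (mega i) f e = up i then width i else 0))"
    using other by (intro sum.cong) auto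
  also have "\<dots> = (card K - 1) * lower i +
      width i * card {f\<in>K - {e}. precedes (mega i) f e = up i}"
    using fK K(2) by (simp add: sum.distrib sum.If_cases Int_def conj_commute)
  finally show ?thesis unfolding c by (simp add: position_def i_def)
qed

text \<open>The ranks fix the positions of the vertices of \<open>e\<close> in the union, and a
  vertex is known from its position because \<open>idx\<close> is injective on the union.\<close>

lemma edge_of_ranks_clique:
  assumes K: "clique K" "e \<in> K"
  shows "e = edge_of_ranks (\<Union>K) (card K) (\<lambda>j. rank K j e)"
proof -
  let ?V = "\<Union>K"
  have fin: "finite e" "finite ?V" and e: "card e = r"
    using K clique_finite_mem[OF K(1)] by (auto simp: clique_def)
  have be: "idx e ` e = {..<r}" using bij_betw_idx[OF fin(1)] e by (simp add: bij_betw_def)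
  have inj: "inj_on (idx ?V) ?V" using bij_betw_idx[OF fin(2)] by (simp add: bij_betw_def)
  have pos: "idx ?V x = position (card K) (idx e x) (rank K (mega (bl (idx e x))) e)"
    if "x \<in> e" for x using idx_Union_clique[OF K that] .
  show ?thesis
  proof (intro equalityI subsetI)
    fix x assume "x \<in> e"
    then show "x \<in> edge_of_ranks ?V (card K) (\<lambda>j. rank K j e)"
      using pos be K(2) unfolding edge_of_ranks_def by blast
  next
    fix x assume x: "x \<in> edge_of_ranks ?V (card K) (\<lambda>j. rank K j e)"
    then obtain p where p: "p < r" "idx ?V x = position (card K) p (rank K (mega (bl p)) e)"
      by (auto simp: edge_of_ranks_def)
    obtain y where y: "y \<in> e" "idx e y = p" using be p(1) by (metis imageE lessThan_iff)
    then have "idx ?V x = idx ?V y" using pos p by simp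
    then have "x = y" using inj x y(1) K(2) by (auto simp: edge_of_ranks_def dest: inj_onD)
    then show "x \<in> e" using y by simp
  qed
qed

lemma rank_less:
  assumes "clique K" "e \<in> K"
  shows "rank K j e < card K"
  unfolding rank_def using assms by (intro psubset_card_mono) (auto simp: clique_def)

text \<open>Every mega-block contains some index \<open>p\<close>. Two edges of equal rank there
  would have their vertices of index \<open>p\<close> at the same position of the union, while
  distinct edges are disjoint.\<close>

lemma inj_on_rank:
  assumes K: "clique K" and j: "j \<le> t"
  shows "inj_on (rank K j) K"
proof
  fix e f assume ef: "e \<in> K" "f \<in> K" "rank K j e = rank K j f"
  obtain p where p: "p < r" "mega (bl p) = j" using mega_bl_surj[OF j] .
  have ex: "\<exists>x\<in>g. idx g x = p" if "g \<in> K" for g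
  proof -
    have "idx g ` g = {..<r}"
      using bij_betw_idx[OF clique_finite_mem[OF K that]] K that
      by (simp add: bij_betw_def clique_def)
    then show ?thesis using p(1) by (metis imageE lessThan_iff)
  qed
  obtain x y where xy: "x \<in> e" "idx e x = p" "y \<in> f" "idx f y = p" using ex ef by metis
  have "idx (\<Union>K) x = idx (\<Union>K) y"
    using idx_Union_clique[OF K ef(1) xy(1)] idx_Union_clique[OF K ef(2) xy(3)] xy ef(3) p(2) by simp
  moreover have "finite (\<Union>K)" using K clique_finite_mem[OF K] by (auto simp: clique_def)
  ultimately have "x = y"
    using bij_betw_idx[of "\<Union>K"] xy ef by (auto simp: bij_betw_def dest: inj_onD)
  then show "e = f" using K ef xy by (auto simp: clique_def pairwise_def disjnt_iff)
qed

text \<open>Rank 0 is a bijection onto \<open>{..<k}\<close> and serves as the name of an edge. The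
  other \<open>t\<close> ranks then become functions of this name, so the exponent in the count
  below is \<open>t * k\<close> and not \<open>(t + 1) * k\<close>.\<close>

lemma clique_determined:
  assumes K: "clique K" "card K = k"
  shows "\<exists>h\<in>{..<k} \<rightarrow>\<^sub>E ({1..t} \<rightarrow>\<^sub>E {..<k}).
    K = (\<lambda>a. edge_of_ranks (\<Union>K) k (\<lambda>j. if j = 0 then a else h a j)) ` {..<k}"
proof -
  have "rank K 0 ` K = {..<k}"
    using inj_on_rank[OF K(1), of 0] rank_less[OF K(1)] K(2)
    by (intro card_subset_eq) (auto simp: card_image)
  then have b: "bij_betw (rank K 0) K {..<k}" using inj_on_rank[OF K(1), of 0] by (simp add: bij_betw_def)
  define g where "g = the_inv_into K (rank K 0)"
  have g: "g a \<in> K" "rank K 0 (g a) = a" if "a < k" for a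
    using b that unfolding g_def bij_betw_def
    by (auto intro: the_inv_into_into f_the_inv_into_f)
  have gK: "g ` {..<k} = K"
    using bij_betw_the_inv_into[OF b] by (simp add: g_def bij_betw_def)
  define h where "h = (\<lambda>a\<in>{..<k}. \<lambda>j\<in>{1..t}. rank K j (g a))"
  have "h \<in> {..<k} \<rightarrow>\<^sub>E ({1..t} \<rightarrow>\<^sub>E {..<k})"
    using rank_less[OF K(1)] g(1) K(2) by (auto simp: h_def)
  moreover have "edge_of_ranks (\<Union>K) k (\<lambda>j. if j = 0 then a else h a j) = g a" if a: "a < k" for a
  proof -
    \<comment> \<open>Agreement for \<open>j \<le> t\<close> is enough, since
      \<open>edge_of_ranks\<close> evaluates ranks only at mega-blocks of indices below
      \<open>r\<close>.\<close>
    have "(if j = 0 then a else h a j) = rank K j (g a)" if "j \<le> t" for j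
      using that a g(2)[OF a] by (auto simp: h_def)
    then have "edge_of_ranks (\<Union>K) k (\<lambda>j. if j = 0 then a else h a j) =
        edge_of_ranks (\<Union>K) k (\<lambda>j. rank K j (g a))"
      unfolding edge_of_ranks_def using bl_less mega_le
      by (intro Collect_cong conj_cong refl arg_cong2[where f = "(\<in>)"] image_cong) auto
    then show ?thesis using edge_of_ranks_clique[OF K(1) g(1)[OF a]] K(2) by simp
  qed
  ultimately show ?thesis using gK by (intro bexI[of _ h]) (auto simp: image_iff)
qed

section \<open>Number of cliques and the first-moment bound\<close>

lemma
  assumes "finite W"
  shows finite_cliques: "finite {K. clique K \<and> card K = k \<and> \<Union>K \<subseteq> W}"
    and card_cliques_le:
      "card {K. clique K \<and> card K = k \<and> \<Union>K \<subseteq> W} \<le> (card W choose (r * k)) * k ^ (t * k)"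
proof -
  let ?S = "{V. V \<subseteq> W \<and> card V = r * k} \<times> ({..<k} \<rightarrow>\<^sub>E ({1..t} \<rightarrow>\<^sub>E {..<k}))"
  let ?C = "{K. clique K \<and> card K = k \<and> \<Union>K \<subseteq> W}"
  show "finite ?C" using assms by (auto intro: finite_subset[of _ "Pow (Pow W)"])
  have fS: "finite ?S"
    using assms by (intro finite_SigmaI finite_PiE) (auto intro: finite_subset[of _ "Pow W"])
  have "?C \<subseteq> (\<lambda>(V, h). (\<lambda>a. edge_of_ranks V k (\<lambda>j. if j = 0 then a else h a j)) ` {..<k}) ` ?S"
  proof
    fix K assume "K \<in> ?C"
    then have K: "clique K" "card K = k" "\<Union>K \<subseteq> W" by auto
    obtain h where h: "h \<in> {..<k} \<rightarrow>\<^sub>E ({1..t} \<rightarrow>\<^sub>E {..<k})"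
      "K = (\<lambda>a. edge_of_ranks (\<Union>K) k (\<lambda>j. if j = 0 then a else h a j)) ` {..<k}"
      using clique_determined[OF K(1,2)] by blast
    have "card (\<Union>K) = r * k"
      using card_Union_uniform[of K r] K r_pos by (auto simp: clique_def)
    then have "(\<Union>K, h) \<in> ?S" using h(1) K(3) by auto
    then show "K \<in> (\<lambda>(V, h). (\<lambda>a. edge_of_ranks V k (\<lambda>j. if j = 0 then a else h a j)) ` {..<k}) ` ?S"
      using h(2) by (intro image_eqI[of _ _ "(\<Union>K, h)"]) auto
  qed
  then have "card ?C \<le> card ?S" using fS by (meson card_image_le card_mono finite_imageI le_trans)
  also have "\<dots> = (card W choose (r * k)) * k ^ (t * k)"
    using assms by (simp add: card_cartesian_product n_subsets card_PiE power_mult)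
  finally show "card ?C \<le> (card W choose (r * k)) * k ^ (t * k)" .
qed

text \<open>A union bound over all cliques of size \<open>k\<close> on the vertex set, each weighted
  by the number of matchings that contain it.\<close>

lemma card_matchings_clique_le:
  "real (card {M\<in>matchings r n. \<exists>K\<subseteq>M. clique K \<and> card K = k}) \<le>
     real k ^ (t * k) * (fact r * real n) ^ k / fact (r * k) * mcount r n"
proof (cases "k \<le> n")
  case False
  have "card K \<le> n" if "K \<subseteq> M" "M \<in> matchings r n" for K M
    using that card_mono[of M K] by (auto simp: matchings_def ordered_matching_def)
  then have "{M\<in>matchings r n. \<exists>K\<subseteq>M. clique K \<and> card K = k} = {}" using False by auto
  then show ?thesis using mcount_pos[of r n] by (simp only:) simp
next
  case True
  let ?W = "{1..r * n}"
  let ?C = "{K. clique K \<and> card K = k \<and> \<Union>K \<subseteq> ?W}"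
  have meq: "matchings r n = avoiding r {} ?W" using matchings_eq_avoiding[OF r_pos] .
  have "{M\<in>matchings r n. \<exists>K\<subseteq>M. clique K \<and> card K = k} \<subseteq>
      (\<Union>K\<in>?C. {M\<in>avoiding r {} ?W. K \<subseteq> M})"
  proof
    fix M assume "M \<in> {M\<in>matchings r n. \<exists>K\<subseteq>M. clique K \<and> card K = k}"
    then obtain K where "M \<in> avoiding r {} ?W" "K \<subseteq> M" "clique K" "card K = k"
      unfolding meq by auto
    moreover from this have "\<Union>K \<subseteq> ?W" unfolding avoiding_def by blast
    ultimately show "M \<in> (\<Union>K\<in>?C. {M\<in>avoiding r {} ?W. K \<subseteq> M})" by blast
  qed
  then have "card {M\<in>matchings r n. \<exists>K\<subseteq>M. clique K \<and> card K = k} \<le>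
      card (\<Union>K\<in>?C. {M\<in>avoiding r {} ?W. K \<subseteq> M})"
    by (rule card_mono[rotated])
      (intro finite_UN_I finite_cliques, auto intro: finite_subset[OF _ finite_avoiding])
  also have "\<dots> \<le> (\<Sum>K\<in>?C. card {M\<in>avoiding r {} ?W. K \<subseteq> M})"
    by (intro card_UN_le finite_cliques) auto
  finally have "real (card {M\<in>matchings r n. \<exists>K\<subseteq>M. clique K \<and> card K = k}) \<le>
      (\<Sum>K\<in>?C. real (card {M\<in>avoiding r {} ?W. K \<subseteq> M}))"
    by (simp only: of_nat_le_iff flip: of_nat_sum)
  also have "\<dots> \<le> (\<Sum>K\<in>?C. mcount r (n - k))"
  proof (rule sum_mono)
    fix K assume "K \<in> ?C"
    then show "real (card {M\<in>avoiding r {} ?W. K \<subseteq> M}) \<le> mcount r (n - k)"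
      using card_matchings_containing_le[of ?W r n K] r_pos by (auto simp: clique_def)
  qed
  also have "\<dots> = real (card ?C) * mcount r (n - k)" by simp
  also have "\<dots> \<le> real ((r * n choose (r * k)) * k ^ (t * k)) * mcount r (n - k)"
  proof (intro mult_right_mono of_nat_mono)
    show "card ?C \<le> (r * n choose (r * k)) * k ^ (t * k)"
      using card_cliques_le[of ?W k] by simp
  qed (use mcount_pos[of r "n - k"] in simp)
  also have "\<dots> = real k ^ (t * k) * (real (r * n choose (r * k)) * mcount r (n - k))" by simp
  \<comment> \<open>The factor \<open>fact (r * (n - k))\<close> cancels between the binomial and
    \<open>mcount\<close>. What remains to estimate is
    \<open>fact n / fact (n - k) \<le> n ^ k\<close>.\<close>
  also have "real (r * n choose (r * k)) * mcount r (n - k) \<le>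
      (fact r * real n) ^ k / fact (r * k) * mcount r n"
  proof -
    have "real (r * n choose (r * k)) = fact (r * n) / (fact (r * k) * fact (r * (n - k)))"
      using True by (subst binomial_fact) (auto simp: diff_mult_distrib2)
    then have "real (r * n choose (r * k)) * mcount r (n - k) =
        fact (r * n) / (fact (r * k) * fact r ^ (n - k)) * (1 / fact (n - k))"
      by (simp add: mcount_def)
    also have "\<dots> \<le> fact (r * n) / (fact (r * k) * fact r ^ (n - k)) * (real n ^ k / fact n)"
    proof (rule mult_left_mono)
      have "fact n div fact (n - k) \<le> n ^ k" by (rule fact_div_fact_le_pow[OF True])
      moreover have "fact n div fact (n - k) * fact (n - k) = (fact n :: nat)"
        by (simp add: fact_dvd)
      ultimately have "(fact n :: nat) \<le> n ^ k * fact (n - k)"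
        by (metis mult_le_mono1)
      then have "real (fact n) \<le> real (n ^ k * fact (n - k))" by (simp only: of_nat_le_iff)
      then show "1 / fact (n - k) \<le> real n ^ k / fact n" by (simp add: field_simps)
    qed simp
    also have "\<dots> = (fact r * real n) ^ k / fact (r * k) * mcount r n"
    proof -
      have "(fact r :: real) ^ n = fact r ^ (n - k) * fact r ^ k"
        using True by (simp flip: power_add)
      then show ?thesis by (simp add: mcount_def power_mult_distrib ac_simps)
    qed
    finally show ?thesis .
  qed
  finally show ?thesis by (simp add: mult_left_mono mult.assoc)
qed

section \<open>Boxes and types of edges\<close>

text \<open>Boxes are numbered from right to left in the rows of blocks of the form \<open>B\<dots>BA\<dots>A\<close>.\<close>

definition box :: "nat \<Rightarrow> nat \<Rightarrow> nat \<Rightarrow> nat \<Rightarrow> nat set" where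
  "box N L i c = (let q = i * N + (if up i then c else N - 1 - c) in {q * L + 1..q * L + L})"

text \<open>Having exactly \<open>width i\<close> vertices in row \<open>i\<close> forces the row of
  a vertex to be the block of its index, so that comparing boxes amounts to comparing pattern
  positions.\<close>

definition typed :: "nat \<Rightarrow> nat \<Rightarrow> (nat \<Rightarrow> nat) \<Rightarrow> nat set \<Rightarrow> bool" where
  "typed N L a e \<longleftrightarrow> (\<forall>j\<le>t. a j < N) \<and> e \<subseteq> (\<Union>i<s. box N L i (a (mega i))) \<and>
     (\<forall>i<s. card (e \<inter> box N L i (a (mega i))) = width i)"

definition edges_outside :: "nat \<Rightarrow> nat \<Rightarrow> (nat \<Rightarrow> nat set) \<Rightarrow> nat set set" where
  "edges_outside N L U = {e. \<exists>a. typed N L a e \<and> (\<forall>j\<le>t. a j \<notin> U j)}"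

lemma finite_box [simp]: "finite (box N L i c)"
  by (simp add: box_def Let_def)

lemma card_box: "card (box N L i c) = L"
  by (simp add: box_def Let_def)

lemma box_less:
  assumes "c < N" "d < N" "x \<in> box N L i c" "y \<in> box N L i' d"
    and "i < i' \<or> i = i' \<and> (if up i then c < d else d < c)"
  shows "x < y"
proof -
  define p q where "p = i * N + (if up i then c else N - 1 - c)"
    and "q = i' * N + (if up i' then d else N - 1 - d)"
  have "p < q"
  proof (cases "i < i'")
    case True
    have "p < i * N + N" unfolding p_def using assms(1) by auto
    also have "\<dots> \<le> i' * N" using True mult_le_mono1[of "Suc i" i' N] by simp
    also have "\<dots> \<le> q" by (simp add: q_def)
    finally show ?thesis .
  next
    case False
    then have "i = i'" "if up i then c < d else d < c" using assms(5) by auto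
    then show ?thesis using assms(1,2) by (auto simp: p_def q_def split: if_splits)
  qed
  then have "Suc p * L \<le> q * L" by (intro mult_le_mono1) simp
  then show ?thesis using assms(3,4) by (auto simp: box_def Let_def simp flip: p_def q_def)
qed

lemma box_less_iff:
  assumes "c < N" "d < N" "x \<in> box N L i c" "y \<in> box N L i' d" "(i, c) \<noteq> (i', d)"
  shows "x < y \<longleftrightarrow> i < i' \<or> i = i' \<and> (up i \<longleftrightarrow> c < d)"
proof -
  have "x < y" if "i < i' \<or> i = i' \<and> (up i \<longleftrightarrow> c < d)"
    using box_less[OF assms(1-4)] that assms(5) by auto
  moreover have "y < x" if "\<not> (i < i' \<or> i = i' \<and> (up i \<longleftrightarrow> c < d))"
  proof (rule box_less[OF assms(2,1,4,3)])
    show "i' < i \<or> i' = i \<and> (if up i' then d < c else c < d)"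
      using that assms(5) by (cases i i' rule: linorder_cases; cases c d rule: linorder_cases) auto
  qed
  ultimately show ?thesis by (metis less_asym)
qed

lemma box_unique:
  assumes "c < N" "d < N" "x \<in> box N L i c" "x \<in> box N L i' d"
  shows "i = i' \<and> c = d"
  using box_less_iff[OF assms] box_less_iff[OF assms(2,1,4,3)]
  by (cases i i' rule: linorder_cases; cases c d rule: linorder_cases) auto

lemma box_subset:
  assumes "i < s" "c < N" "s * N * L \<le> m"
  shows "box N L i c \<subseteq> {1..m}"
proof -
  define q where "q = i * N + (if up i then c else N - 1 - c)"
  have "Suc q \<le> i * N + N" using assms(2) by (auto simp: q_def)
  also have "\<dots> \<le> s * N" using assms(1) mult_le_mono1[of "Suc i" s N] by simp
  finally have "Suc q * L \<le> s * N * L" by (rule mult_le_mono1)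
  then show ?thesis using assms(3) by (auto simp: box_def Let_def simp flip: q_def)
qed

section \<open>Recovering blocks and types from the boxes of an edge\<close>

lemma width_pos: "i < s \<Longrightarrow> width i \<ge> 1"
proof -
  assume "i < s"
  then obtain p where "p < r" "bl p = i" using bl_image by (metis imageE lessThan_iff)
  then have "{q. q < r \<and> bl q = i} \<noteq> {}" by auto
  then have "width i \<noteq> 0" by (simp add: width_def)
  then show ?thesis by simp
qed

lemma sum_width: "i \<le> s \<Longrightarrow> (\<Sum>i'<i. width i') = lower i"
proof -
  have "lower i = card (\<Union>i'<i. {q. q < r \<and> bl q = i'})"
    unfolding lower_def by (rule arg_cong[where f = card]) auto
  also have "\<dots> = (\<Sum>i'<i. width i')"
    unfolding width_def by (intro card_UN_disjoint) auto
  finally show ?thesis by simp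
qed

lemma sum_width_all: "(\<Sum>i<s. width i) = r"
proof -
  have "{q. q < r \<and> bl q < s} = {..<r}" using bl_less by auto
  then show ?thesis using sum_width[of s] by (simp add: lower_def)
qed

text \<open>As \<open>bl\<close> is monotone, the positions in blocks before \<open>i\<close> form
  an initial segment, and its length is \<open>lower i\<close>.\<close>

lemma bl_eqI:
  assumes "lower i \<le> p" "p < lower (Suc i)"
  shows "bl p = i"
proof (rule ccontr)
  have "lower (Suc i) \<le> r" 
    unfolding lower_def using card_mono[of "{..<r}" "{q. q < r \<and> bl q < Suc i}"] by auto
  then have p: "p < r" using assms by simp
  assume "bl p \<noteq> i"
  then consider "bl p < i" | "bl p > i" by linarith
  then show False
  proof cases
    case 1
    then have "{..p} \<subseteq> {q. q < r \<and> bl q < i}"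
      using p bl_mono by (auto intro: le_less_trans)
    then have "card {..p} \<le> lower i" unfolding lower_def by (intro card_mono) auto
    then show False using assms by simp
  next
    case 2
    have "{q. q < r \<and> bl q < Suc i} \<subseteq> {..<p}"
    proof
      fix q assume "q \<in> {q. q < r \<and> bl q < Suc i}"
      then show "q \<in> {..<p}" using 2 bl_mono[of p q] by (cases "q < p") auto
    qed
    then have "lower (Suc i) \<le> card {..<p}" unfolding lower_def by (intro card_mono) auto
    then show False using assms by simp
  qed
qed

lemma typed_finite: "typed N L a e \<Longrightarrow> finite e"
  unfolding typed_def by (auto intro: finite_subset)

lemma card_typed_initial:
  assumes "typed N L a e" "i \<le> s"
  shows "card (\<Union>i'<i. e \<inter> box N L i' (a (mega i'))) = lower i"
proof -
  have "card (\<Union>i'<i. e \<inter> box N L i' (a (mega i'))) =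
      (\<Sum>i'<i. card (e \<inter> box N L i' (a (mega i'))))"
  proof (rule card_UN_disjoint)
    show "\<forall>i'\<in>{..<i}. \<forall>j\<in>{..<i}. i' \<noteq> j \<longrightarrow>
      (e \<inter> box N L i' (a (mega i'))) \<inter> (e \<inter> box N L j (a (mega j))) = {}"
    proof (intro ballI impI)
      fix i' j assume ij: "i' \<in> {..<i}" "j \<in> {..<i}" "i' \<noteq> j"
      then have "a (mega i') < N" "a (mega j) < N"
        using assms mega_le[of i'] mega_le[of j] by (simp_all add: typed_def)
      then show "(e \<inter> box N L i' (a (mega i'))) \<inter> (e \<inter> box N L j (a (mega j))) = {}"
        using box_unique[of "a (mega i')" N "a (mega j)" _ L i' j] ij(3) by auto
    qed
  qed auto
  also have "\<dots> = (\<Sum>i'<i. width i')"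
    using assms by (intro sum.cong) (auto simp: typed_def)
  finally show ?thesis using sum_width[OF assms(2)] by simp
qed

lemma card_typed:
  assumes "typed N L a e"
  shows "card e = r"
proof -
  have "(\<Union>i'<s. e \<inter> box N L i' (a (mega i'))) = e" using assms unfolding typed_def by blast
  then show ?thesis
    using card_typed_initial[OF assms, of s] sum_width_all sum_width[of s] by simp
qed

text \<open>The \<open>lower i\<close> vertices of \<open>e\<close> in earlier rows are all to the
  left of \<open>x\<close>, and every vertex to the left of \<open>x\<close> lies in row
  \<open>i\<close> or an earlier one.\<close>

lemma bl_idx_typed:
  assumes e: "typed N L a e" and x: "x \<in> e" "x \<in> box N L i (a (mega i))" and i: "i < s"
  shows "bl (idx e x) = i"
proof (rule bl_eqI)
  let ?E = "\<lambda>k. \<Union>i'<k. e \<inter> box N L i' (a (mega i'))"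
  have range: "a (mega i') < N" if "i' < s" for i' using e that mega_le by (simp add: typed_def)
  have fin: "finite e" using typed_finite[OF e] .
  have "?E i \<subseteq> {y\<in>e. y < x}"
  proof clarify
    fix i' y assume "i' < i" "y \<in> e" "y \<in> box N L i' (a (mega i'))"
    then show "y < x" using box_less[OF range range _ x(2), of i'] i by auto
  qed
  then have "card (?E i) \<le> idx e x" unfolding idx_def using fin by (intro card_mono) auto
  then show "lower i \<le> idx e x" using card_typed_initial[OF e, of i] i by simp
  \<comment> \<open>The inclusion is proper because \<open>x\<close> itself lies in row
    \<open>i\<close>; this gives the strict upper bound on the index.\<close>
  have "{y\<in>e. y < x} \<subset> ?E (Suc i)"
  proof (rule psubsetI)
    show "{y\<in>e. y < x} \<subseteq> ?E (Suc i)"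
    proof
      fix y assume y: "y \<in> {y\<in>e. y < x}"
      then obtain i' where i': "i' < s" "y \<in> box N L i' (a (mega i'))"
        using e unfolding typed_def by blast
      have "\<not> i < i'" using box_less[OF range range x(2) i'(2)] i i'(1) y by auto
      then show "y \<in> ?E (Suc i)" using i' y by auto
    qed
    have "x \<in> ?E (Suc i)" using x by auto
    then show "{y\<in>e. y < x} \<noteq> ?E (Suc i)" by auto
  qed
  then have "idx e x < card (?E (Suc i))"
    unfolding idx_def using fin by (intro psubset_card_mono) auto
  then show "idx e x < lower (Suc i)" using card_typed_initial[OF e, of "Suc i"] i by simp
qed

text \<open>The numbering of the boxes absorbs \<open>up\<close>: in all rows of mega-block
  \<open>j\<close> the truth of \<open>a j < b j\<close> acts as the absence of a flip.\<close>

lemma compatible_typed: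
  assumes "typed N L a e" "typed N L b f" "\<forall>j\<le>t. a j \<noteq> b j"
  shows "compatible e f"
proof -
  have *: "compatible e f"
    if e: "typed N L a e" and f: "typed N L b f" and neq: "\<forall>j\<le>t. a j \<noteq> b j" and "a 0 < b 0"
    for a b e f
  proof -
    \<comment> \<open>The edge with the smaller coordinate 0 takes the letter \<open>LA\<close>, as
      mega-block 0 is never flipped. The flips are then the coordinates ordered the other
      way.\<close>
    define F where "F = {j\<in>{1..t}. b j < a j}"
    have F: "j \<notin> F \<longleftrightarrow> a j < b j" if "j \<le> t" for j
      using that neq \<open>a 0 < b 0\<close> by (cases "j = 0") (auto simp: F_def Suc_le_eq)
    have "separated (before F) e f"
      unfolding separated_def
    proof (intro ballI)
      fix x y assume "x \<in> e" "y \<in> f"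
      then obtain i i' where i: "i < s" "x \<in> box N L i (a (mega i))"
        and i': "i' < s" "y \<in> box N L i' (b (mega i'))"
        using e f unfolding typed_def by blast
      have "x < y \<longleftrightarrow> i < i' \<or> i = i' \<and> (up i \<longleftrightarrow> a (mega i) < b (mega i'))"
        using e f neq i i' mega_le by (intro box_less_iff) (auto simp: typed_def)
      then show "x < y \<longleftrightarrow> before F (idx e x) (idx f y)"
        using bl_idx_typed[OF e \<open>x \<in> e\<close> i(2,1)] bl_idx_typed[OF f \<open>y \<in> f\<close> i'(2,1)]
          F[OF mega_le[OF i(1)]]
        by (auto simp: before_def)
    qed
    moreover have "F \<subseteq> {1..t}" by (auto simp: F_def)
    ultimately show ?thesis unfolding compatible_def by blast
  qed
  show ?thesis
  proof (cases "a 0 < b 0")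
    case True
    then show ?thesis using * assms by blast
  next
    case False
    then have "b 0 < a 0" using assms(3) by (metis linorder_neqE_nat zero_le)
    moreover have "\<forall>j\<le>t. b j \<noteq> a j" using assms(3) by metis
    ultimately show ?thesis using *[OF assms(2,1)] compatible_sym by blast
  qed
qed

lemma typed_nonempty:
  assumes "typed N L a e" "i < s"
  obtains x where "x \<in> e" "x \<in> box N L i (a (mega i))"
proof -
  have "card (e \<inter> box N L i (a (mega i))) \<noteq> 0"
    using assms width_pos[OF assms(2)] by (auto simp: typed_def)
  then have "e \<inter> box N L i (a (mega i)) \<noteq> {}" by (metis card.empty)
  then show ?thesis using that by auto
qed

lemma type_unique:
  assumes e: "typed N L a e" "typed N L b e" and j: "j \<le> t"
  shows "a j = b j"
proof -
  obtain i where i: "i < s" "mega i = j" using j mega_image by (metis atMost_iff imageE lessThan_iff)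
  obtain x where x: "x \<in> e" "x \<in> box N L i (a (mega i))" using typed_nonempty[OF e(1) i(1)] .
  then obtain i' where i': "i' < s" "x \<in> box N L i' (b (mega i'))"
    using e(2) unfolding typed_def by blast
  have "i = i' \<and> a (mega i) = b (mega i')"
    using e i i' mega_le by (intro box_unique[OF _ _ x(2) i'(2)]) (auto simp: typed_def)
  then show ?thesis using i by auto
qed

text \<open>\<open>K\<close> is a maximal set of edges whose types differ in every coordinate, and \<open>U j\<close> is the set of
  used \<open>j\<close>-th coordinates.\<close>

lemma maximal_clique:
  assumes M: "M \<in> matchings r n"
  shows "\<exists>K\<subseteq>M. clique K \<and> (\<exists>U. (\<forall>j\<le>t. U j \<subseteq> {..<N} \<and> card (U j) \<le> card K) \<and>
    M \<inter> edges_outside N L U = {})"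
proof -
  have M': "finite M" "disjoint M" "\<forall>e\<in>M. card e = r"
    using M by (auto simp: matchings_def ordered_matching_def)
  define good where "good \<tau> K \<longleftrightarrow> K \<subseteq> M \<and> (\<forall>e\<in>K. typed N L (\<tau> e) e) \<and>
    (\<forall>e\<in>K. \<forall>f\<in>K. e \<noteq> f \<longrightarrow> (\<forall>j\<le>t. \<tau> e j \<noteq> \<tau> f j))" for \<tau> K
  have "\<exists>K. (\<exists>\<tau>. good \<tau> K) \<and> (\<forall>K'. (\<exists>\<tau>. good \<tau> K') \<longrightarrow> card K' \<le> card K)"
  proof (rule Lattices_Big.ex_has_greatest_nat)
    show "\<exists>\<tau>. good \<tau> {}" by (simp add: good_def)
    show "\<forall>K. (\<exists>\<tau>. good \<tau> K) \<longrightarrow> card K < Suc (card M)"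
      using M'(1) by (auto simp: good_def less_Suc_eq_le intro: card_mono)
  qed
  then obtain K \<tau> where K: "good \<tau> K" and max: "\<And>K' \<tau>. good \<tau> K' \<Longrightarrow> card K' \<le> card K"
    by blast
  have KM: "K \<subseteq> M" "finite K" using K M'(1) by (auto simp: good_def intro: finite_subset)
  have "compatible e f" if "e \<in> K" "f \<in> K" "e \<noteq> f" for e f
    using compatible_typed[of N L "\<tau> e" e "\<tau> f" f] K that by (auto simp: good_def)
  then have "clique K"
    using KM M' pairwise_subset[OF M'(2) KM(1)] unfolding clique_def by auto
  moreover define U where "U j = (\<lambda>e. \<tau> e j) ` K" for j
  have "U j \<subseteq> {..<N} \<and> card (U j) \<le> card K" if "j \<le> t" for j
    using K KM(2) that by (auto simp: U_def good_def typed_def card_image_le)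
  moreover have "M \<inter> edges_outside N L U = {}"
  proof (rule ccontr)
    assume "M \<inter> edges_outside N L U \<noteq> {}"
    then obtain e a where e: "e \<in> M" "typed N L a e" "\<forall>j\<le>t. a j \<notin> U j"
      by (auto simp: edges_outside_def)
    have "e \<notin> K"
    proof
      assume "e \<in> K"
      then have "a 0 = \<tau> e 0" using K e(2) by (auto simp: good_def intro: type_unique)
      then show False using e(3) \<open>e \<in> K\<close> by (auto simp: U_def)
    qed
    moreover have "good (\<tau>(e := a)) (insert e K)"
    proof -
      have "\<tau> f j \<in> U j" if "f \<in> K" for f j using that by (auto simp: U_def)
      then have "a j \<noteq> \<tau> f j" "\<tau> f j \<noteq> a j" if "f \<in> K" "j \<le> t" for f j
        using e(3) that by metis+
      then show ?thesis using K e(1,2) \<open>e \<notin> K\<close> by (auto simp: good_def)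
    qed
    ultimately show False using max[of "\<tau>(e := a)" "insert e K"] KM(2) by simp
  qed
  ultimately show ?thesis using KM(1) by blast
qed

text \<open>A type with good coordinates can be chosen in at least \<open>g ^ Suc t\<close> ways.
  For each, \<open>width i\<close> vertices are picked independently from the box in row
  \<open>i\<close>; since the widths sum to \<open>r\<close>, the binomials multiply to at least
  \<open>(h / r) ^ r\<close>.\<close>

lemma card_edges_outside_ge:
  assumes W: "finite W"
    and good: "\<And>j. j \<le> t \<Longrightarrow> good j \<subseteq> {..<N} - U j" "\<And>j. j \<le> t \<Longrightarrow> g \<le> card (good j)"
    and h: "\<And>i c. i < s \<Longrightarrow> c \<in> good (mega i) \<Longrightarrow> h \<le> card (box N L i c \<inter> W)" "r \<le> h"
  shows "real g ^ Suc t * (real h / real r) ^ r \<le>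
    real (card {e\<in>edges_outside N L U. e \<subseteq> W \<and> card e = r})"
proof -
  let ?A = "\<Pi>\<^sub>E j\<in>{..t}. good j"
  let ?P = "\<lambda>a i. {E. E \<subseteq> box N L i (a (mega i)) \<inter> W \<and> card E = width i}"
  let ?B = "\<lambda>a. \<Pi>\<^sub>E i\<in>{..<s}. ?P a i"
  let ?f = "\<lambda>(a::nat \<Rightarrow> nat, E). \<Union>i<s. E i :: nat set"
  have fgood: "finite (good j)" if "j \<le> t" for j using good(1)[OF that] finite_subset by auto
  have fP: "finite (?P a i)" for a i by (rule finite_subset[of _ "Pow (box N L i (a (mega i)))"]) auto
  have range: "a (mega i) < N" if "a \<in> ?A" "i < s" for a i
    using that good(1)[of "mega i"] mega_le[of i] by (auto simp: PiE_def Pi_def)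
  have E: "E i \<subseteq> box N L i (a (mega i)) \<inter> W" "card (E i) = width i"
    if "E \<in> ?B a" "i < s" for E a i using that by (auto simp: PiE_def Pi_def)
  \<comment> \<open>Cutting the edge with a whole row recovers the part chosen there without
    knowledge of the type. This is what makes the parametrization injective.\<close>
  have row: "(\<Union>i<s. E i) \<inter> (\<Union>c<N. box N L i c) = E i" if "a \<in> ?A" "E \<in> ?B a" "i < s" for a E i
  proof (intro equalityI subsetI)
    fix x assume "x \<in> (\<Union>i<s. E i) \<inter> (\<Union>c<N. box N L i c)"
    then obtain i' c where i': "i' < s" "x \<in> E i'" "c < N" "x \<in> box N L i c" by auto
    then have "x \<in> box N L i' (a (mega i'))" using E(1)[OF that(2) i'(1)] by auto
    then have "i = i'" using box_unique[OF i'(3) range[OF that(1) i'(1)] i'(4)] by simp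
    then show "x \<in> E i" using i' by simp
  next
    fix x assume "x \<in> E i"
    then show "x \<in> (\<Union>i<s. E i) \<inter> (\<Union>c<N. box N L i c)"
      using E(1)[OF that(2,3)] range[OF that(1,3)] that(3) by auto
  qed
  have inj: "inj_on ?f (SIGMA a:?A. ?B a)"
  proof (rule inj_onI, clarify)
    fix a E a' E'
    assume a: "a \<in> ?A" "E \<in> ?B a" and a': "a' \<in> ?A" "E' \<in> ?B a'"
      and eq: "(\<Union>i<s. E i) = (\<Union>i<s. E' i)"
    have EE: "E i = E' i" if "i < s" for i using row[OF a that] row[OF a' that] eq by simp
    have "a j = a' j" if j: "j \<le> t" for j
    proof -
      obtain i where i: "i < s" "mega i = j" using j mega_image by (metis atMost_iff imageE lessThan_iff)
      have "E i \<noteq> {}" using E(2)[OF a(2) i(1)] width_pos[OF i(1)] by auto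
      then obtain x where "x \<in> E i" by auto
      then have "x \<in> box N L i (a j)" "x \<in> box N L i (a' j)"
        using E(1)[OF a(2) i(1)] E(1)[OF a'(2) i(1)] EE[OF i(1)] i(2) by auto
      then show ?thesis using box_unique range[OF a(1) i(1)] range[OF a'(1) i(1)] i(2) by blast
    qed
    then have "a = a'" using a(1) a'(1) by (intro PiE_ext) auto
    moreover have "E = E'"
      using PiE_ext[OF a(2), of E'] a'(2) EE \<open>a = a'\<close> by simp
    ultimately show "a = a' \<and> E = E'" by simp
  qed
  have into: "?f ` (SIGMA a:?A. ?B a) \<subseteq> {e\<in>edges_outside N L U. e \<subseteq> W \<and> card e = r}"
  proof clarify
    fix a E assume a: "a \<in> ?A" "E \<in> ?B a"
    have aj: "a j < N" "a j \<notin> U j" if "j \<le> t" for j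
      using a(1) good(1)[OF that] that by (auto simp: PiE_def Pi_def)
    have "(\<Union>i<s. E i) \<inter> box N L i (a (mega i)) = E i" if "i < s" for i
      using row[OF a that] E(1)[OF a(2) that] range[OF a(1) that] by blast
    then have ty: "typed N L a (\<Union>i<s. E i)"
      unfolding typed_def using E[OF a(2)] aj(1) by (intro conjI allI impI UN_mono) auto
    then have "(\<Union>i<s. E i) \<in> edges_outside N L U"
      using aj(2) unfolding edges_outside_def by blast
    moreover have "(\<Union>i<s. E i) \<subseteq> W" using E(1)[OF a(2)] by blast
    ultimately show "(\<Union>i<s. E i) \<in> edges_outside N L U \<and> (\<Union>i<s. E i) \<subseteq> W \<and>
        card (\<Union>i<s. E i) = r"
      using card_typed[OF ty] by simp
  qed
  have prod: "(real h / real r) ^ r \<le> real (card (?B a))" if a: "a \<in> ?A" for a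
  proof -
    have "(real h / real r) ^ r = (\<Prod>i<s. (real h / real r) ^ width i)"
      by (simp only: power_sum[symmetric] sum_width_all)
    also have "\<dots> \<le> (\<Prod>i<s. real (card (?P a i)))"
    proof (intro prod_mono conjI)
      fix i assume "i \<in> {..<s}"
      then have i: "i < s" by simp
      let ?Y = "box N L i (a (mega i)) \<inter> W"
      have hY: "h \<le> card ?Y"
        using h(1)[OF i, of "a (mega i)"] a mega_le[OF i] by (auto simp: PiE_def Pi_def)
      have "width i \<le> (\<Sum>i<s. width i)" using i by (intro member_le_sum) auto
      then have w: "1 \<le> width i" "width i \<le> r" using width_pos[OF i] sum_width_all by auto
      have "(real h / real r) ^ width i \<le> (real (card ?Y) / real (width i)) ^ width i"
        using hY w by (intro power_mono frac_le) auto
      \<comment> \<open>The bound \<open>(n / k) ^ k\<close> on a binomial requires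
        \<open>k \<le> n\<close>; here \<open>width i \<le> r \<le> h \<le> card ?Y\<close>.\<close>
      also have "\<dots> \<le> real (card ?Y choose width i)"
        using hY w h(2) by (intro binomial_ge_n_over_k_pow_k) auto
      also have "card ?Y choose width i = card (?P a i)"
        by (intro n_subsets[symmetric]) simp
      finally show "(real h / real r) ^ width i \<le> real (card (?P a i))" .
    qed simp
    also have "\<dots> = real (card (?B a))" by (simp add: card_PiE)
    finally show ?thesis .
  qed
  have "real g ^ Suc t * (real h / real r) ^ r \<le> (\<Sum>a\<in>?A. (real h / real r) ^ r)"
  proof -
    have "real g ^ Suc t = (\<Prod>j\<le>t. real g)" by simp
    also have "\<dots> \<le> (\<Prod>j\<le>t. real (card (good j)))" using good(2) by (intro prod_mono) auto
    also have "\<dots> = real (card ?A)" by (simp add: card_PiE)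
    finally show ?thesis by (simp only: sum_constant) (intro mult_right_mono, auto)
  qed
  also have "\<dots> \<le> (\<Sum>a\<in>?A. real (card (?B a)))" using prod by (intro sum_mono)
  also have "\<dots> = real (card (SIGMA a:?A. ?B a))"
    using fgood fP by (subst card_SigmaI) (auto intro!: finite_PiE)
  also have "\<dots> \<le> real (card {e\<in>edges_outside N L U. e \<subseteq> W \<and> card e = r})"
  proof (intro of_nat_mono card_inj_on_le[OF inj into])
    show "finite {e\<in>edges_outside N L U. e \<subseteq> W \<and> card e = r}"
      using W by (auto intro: finite_subset[of _ "Pow W"])
  qed
  finally show ?thesis .
qed

text \<open>A depleted box has lost at least \<open>h\<close> of its \<open>L\<close> vertices. The
  boxes are disjoint and at most \<open>h * b\<close> vertices are missing altogether.\<close>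

lemma card_depleted_le:
  assumes "W \<subseteq> {1..m}" "m - card W \<le> h * b" "s * N * L \<le> m" "2 * h \<le> L" "h \<ge> 1"
  shows "card {(i, c). i < s \<and> c < N \<and> card (box N L i c \<inter> W) < h} \<le> b" (is "card ?B \<le> b")
proof -
  have fB: "finite ?B" by (rule finite_subset[of _ "{..<s} \<times> {..<N}"]) auto
  have "h * card ?B = (\<Sum>(i, c)\<in>?B. h)" by simp
  also have "\<dots> \<le> (\<Sum>(i, c)\<in>?B. card (box N L i c - W))"
  proof (intro sum_mono, clarify)
    fix i c assume "card (box N L i c \<inter> W) < h"
    moreover have "card (box N L i c - W) + card (box N L i c \<inter> W) = L"
      using card_box[of N L i c] card_Diff_subset_Int[of "box N L i c" W]
        card_mono[of "box N L i c" "box N L i c \<inter> W"] by auto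
    ultimately show "h \<le> card (box N L i c - W)" using assms(4) by linarith
  qed
  also have "\<dots> = (\<Sum>z\<in>?B. card (box N L (fst z) (snd z) - W))"
    by (intro sum.cong) auto
  also have "\<dots> = card (\<Union>z\<in>?B. box N L (fst z) (snd z) - W)"
  proof (rule card_UN_disjoint[symmetric, OF fB])
    show "\<forall>z\<in>?B. \<forall>z'\<in>?B. z \<noteq> z' \<longrightarrow>
      (box N L (fst z) (snd z) - W) \<inter> (box N L (fst z') (snd z') - W) = {}"
      using box_unique by fastforce
  qed auto
  also have "\<dots> \<le> card ({1..m} - W)"
    using box_subset[OF _ _ assms(3)] by (intro card_mono) fastforce+
  also have "\<dots> = m - card W" using assms(1) by (simp add: card_Diff_subset finite_subset)
  finally have "h * card ?B \<le> h * b" using assms(2) by linarith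
  then show ?thesis using assms(5) by simp
qed

text \<open>In each coordinate at most \<open>u\<close> values are used and at most \<open>b\<close>
  belong to depleted boxes, so \<open>g\<close> remain throughout the first \<open>J\<close>
  exposures. The number \<open>p\<close> bounds the density of suitable edges from below, and
  \<open>2 ^ (N * Suc t)\<close> counts the choices of the used coordinates.\<close>

lemma card_matchings_few_le:
  assumes sizes: "s * N * L \<le> r * n" "2 * h \<le> L" "r \<le> h" "r * J \<le> h * b" "g + u + b \<le> N" "J \<le> n"
    and p: "p = real g ^ Suc t * (real h / real r) ^ r / (real r * real n) ^ r"
  shows "real (card {M\<in>matchings r n. \<forall>K\<subseteq>M. clique K \<longrightarrow> card K \<le> u}) \<le>
    2 ^ (N * Suc t) * (1 - p) ^ J * mcount r n" (is "real (card ?F) \<le> _") and "p \<le> 1"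
proof -
  let ?V = "{1..r * n}"
  have main: "p * real (card W choose r) \<le>
      real (card {e\<in>edges_outside N L U. e \<subseteq> W \<and> card e = r})"
    if W: "W \<subseteq> ?V" "r * (n - J) \<le> card W" and U: "\<forall>j\<le>t. U j \<subseteq> {..<N} \<and> card (U j) \<le> u"
    for W U
  proof -
    have fW: "finite W" using W(1) finite_subset by blast
    let ?B = "{(i, c). i < s \<and> c < N \<and> card (box N L i c \<inter> W) < h}"
    have "r * n - card W \<le> h * b"
      using W(2) sizes(4) by (simp add: diff_mult_distrib2)
    then have B: "card ?B \<le> b"
      using r_pos sizes(1-3) by (intro card_depleted_le[OF W(1)]) auto
    have fB: "finite ?B" by (rule finite_subset[of _ "{..<s} \<times> {..<N}"]) auto
    \<comment> \<open>A number \<open>c\<close> is discarded for every coordinate as soon as its box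
      is depleted in any row. At most \<open>b\<close> numbers are lost in this way.\<close>
    define good where "good j = {..<N} - (U j \<union> snd ` ?B)" for j
    have "real g ^ Suc t * (real h / real r) ^ r \<le>
        real (card {e\<in>edges_outside N L U. e \<subseteq> W \<and> card e = r})"
    proof (rule card_edges_outside_ge[OF fW, of good])
      fix j assume j: "j \<le> t"
      show "good j \<subseteq> {..<N} - U j" by (auto simp: good_def)
      have "card (U j \<union> snd ` ?B) \<le> card (U j) + card (snd ` ?B)" by (rule card_Un_le)
      also have "\<dots> \<le> u + b" using U j B card_image_le[OF fB, of snd] by (intro add_mono) auto
      finally have "N - (u + b) \<le> card (good j)"
        using diff_card_le_card_Diff[of "U j \<union> snd ` ?B" "{..<N}"] U j fB finite_subset
        by (fastforce simp: good_def)
      then show "g \<le> card (good j)" using sizes(5) by linarith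
    next
      fix i c assume "i < s" "c \<in> good (mega i)"
      moreover from this have "c < N" "c \<notin> snd ` ?B" by (auto simp: good_def)
      moreover have "(i, c) \<in> ?B \<Longrightarrow> c \<in> snd ` ?B" by (erule rev_image_eqI) simp
      ultimately show "h \<le> card (box N L i c \<inter> W)" by (auto simp: not_less)
    qed (rule sizes)
    moreover have "p * real (card W choose r) \<le> real g ^ Suc t * (real h / real r) ^ r"
    proof (cases "r \<le> card W")
      case False
      then show ?thesis by (simp add: binomial_eq_0)
    next
      case True
      have "card W \<le> r * n" using card_mono[OF _ W(1)] by simp
      then have "real (card W) \<le> real r * real n" by (metis of_nat_le_iff of_nat_mult)
      moreover have "real (card W choose r) \<le> real (card W) ^ r"
        using binomial_le_pow[OF True] by (simp flip: of_nat_power)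
      ultimately have "real (card W choose r) \<le> (real r * real n) ^ r"
        by (meson order_trans power_mono of_nat_0_le_iff)
      then have "real (card W choose r) / (real r * real n) ^ r \<le> 1"
        by (intro divide_le_eq_1[THEN iffD2]) (auto simp: zero_less_mult_iff)
      then have "real g ^ Suc t * (real h / real r) ^ r * (real (card W choose r) / (real r * real n) ^ r)
          \<le> real g ^ Suc t * (real h / real r) ^ r * 1"
        by (intro mult_left_mono) auto
      then show ?thesis by (simp add: p)
    qed
    ultimately show ?thesis by linarith
  qed
  have p0: "0 \<le> p" by (simp add: p)
  \<comment> \<open>The numerator is at most \<open>(N * L) ^ r\<close>, because
    \<open>g \<le> N\<close>, \<open>Suc t \<le> r\<close> and \<open>h / r \<le> L\<close>, and the
    boxes of one row fit into \<open>r * n\<close> vertices.\<close>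
  show p1: "p \<le> 1"
  proof -
    have tr: "Suc t \<le> r" using t_less_s s_le_r by simp
    show ?thesis
    proof (cases "g = 0")
      case False
      then have N: "N \<ge> 1" using sizes(5) by simp
      have "real g ^ Suc t \<le> real N ^ Suc t" using sizes(5) by (intro power_mono) auto
      also have "\<dots> \<le> real N ^ r" using N tr by (intro power_increasing) auto
      finally have 1: "real g ^ Suc t \<le> real N ^ r" .
      have "h \<le> L * r" using sizes(2) mult_le_mono2[OF r_pos, of L] by linarith
      then have "real h \<le> real L * real r" by (metis of_nat_le_iff of_nat_mult)
      then have "real h / real r \<le> real L" using r_pos by (simp add: divide_le_eq)
      then have 2: "(real h / real r) ^ r \<le> real L ^ r" by (intro power_mono) auto
      have "N * L \<le> s * (N * L)" using mult_le_mono1[of 1 s "N * L"] t_less_s by simp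
      then have "N * L \<le> s * N * L" by (simp only: mult.assoc)
      then have "real (N * L) \<le> real (r * n)" using sizes(1) by (simp only: of_nat_le_iff)
      then have "(real N * real L) ^ r \<le> (real r * real n) ^ r" by (intro power_mono) auto
      moreover have "real g ^ Suc t * (real h / real r) ^ r \<le> real N ^ r * real L ^ r"
        using 1 2 by (intro mult_mono) auto
      ultimately have "real g ^ Suc t * (real h / real r) ^ r \<le> (real r * real n) ^ r"
        unfolding power_mult_distrib by linarith
      \<comment> \<open>The case \<open>y = 0\<close> covers \<open>n = 0\<close>, where the
        quotient has the default value 0.\<close>
      moreover have "x / y \<le> 1" if "x \<le> y" "0 \<le> y" for x y :: real
        using that by (cases "y = 0") auto
      ultimately show ?thesis unfolding p by simp
    qed (simp add: p)
  qed
  let ?U = "{..t} \<rightarrow>\<^sub>E Pow {..<N}"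
  let ?U' = "{U\<in>?U. \<forall>j\<le>t. card (U j) \<le> u}"
  have meq: "matchings r n = avoiding r {} ?V" using matchings_eq_avoiding[OF r_pos] .
  have "?F \<subseteq> (\<Union>U\<in>?U'. avoiding r (edges_outside N L U) ?V)"
  proof
    fix M assume M: "M \<in> ?F"
    then obtain K U where K: "K \<subseteq> M" "clique K" "\<forall>j\<le>t. U j \<subseteq> {..<N} \<and> card (U j) \<le> card K"
      "M \<inter> edges_outside N L U = {}"
      using maximal_clique[of M n N L] by blast
    \<comment> \<open>Only the values of \<open>U\<close> up to \<open>t\<close> matter; restriction
      puts it among finitely many extensional functions.\<close>
    let ?R = "restrict U {..t}"
    have "edges_outside N L ?R = edges_outside N L U" by (simp add: edges_outside_def)
    then have "M \<in> avoiding r (edges_outside N L ?R) ?V"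
      using M K(4) unfolding meq by (simp add: avoiding_def)
    moreover have "card K \<le> u" using K(1,2) M by blast
    then have "U j \<subseteq> {..<N}" "card (U j) \<le> u" if "j \<le> t" for j
      using K(3) that le_trans by blast+
    then have "?R \<in> ?U'" by auto
    ultimately show "M \<in> (\<Union>U\<in>?U'. avoiding r (edges_outside N L U) ?V)" by blast
  qed
  moreover have fU: "finite ?U'" by (intro finite_subset[of ?U' ?U]) (auto intro: finite_PiE)
  ultimately have "card ?F \<le> card (\<Union>U\<in>?U'. avoiding r (edges_outside N L U) ?V)"
    by (intro card_mono finite_UN_I finite_avoiding) auto
  also have "\<dots> \<le> (\<Sum>U\<in>?U'. card (avoiding r (edges_outside N L U) ?V))"
    by (rule card_UN_le[OF fU])
  finally have "real (card ?F) \<le> (\<Sum>U\<in>?U'. real (card (avoiding r (edges_outside N L U) ?V)))"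
    by (simp only: of_nat_le_iff flip: of_nat_sum)
  also have "\<dots> \<le> (\<Sum>U\<in>?U'. (1 - p) ^ J * mcount r n)"
  proof (rule sum_mono)
    fix U assume "U \<in> ?U'"
    then have "\<forall>j\<le>t. U j \<subseteq> {..<N} \<and> card (U j) \<le> u" by (auto simp: PiE_def Pi_def)
    then show "real (card (avoiding r (edges_outside N L U) ?V)) \<le> (1 - p) ^ J * mcount r n"
      using main p0 p1 r_pos sizes(6) by (intro card_avoiding_le) auto
  qed
  also have "\<dots> = real (card ?U') * ((1 - p) ^ J * mcount r n)" by simp
  also have "\<dots> \<le> real (card ?U) * ((1 - p) ^ J * mcount r n)"
    using p1 mcount_pos[of r n]
    by (intro mult_right_mono of_nat_mono card_mono) (auto intro: finite_PiE)
  also have "real (card ?U) = 2 ^ (N * Suc t)"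
    by (simp add: card_PiE card_Pow power_mult power_add)
  finally show "real (card ?F) \<le> 2 ^ (N * Suc t) * (1 - p) ^ J * mcount r n" by simp
qed

end

section \<open>Asymptotics\<close>

text \<open>The quotient \<open>m ^ m / fact m\<close> is a single term of the series of
  \<open>exp m\<close>.\<close>

lemma power_self_le_fact_exp: "real m ^ m \<le> fact m * exp (real m)"
proof -
  have "(\<Sum>n\<in>{m}. real m ^ n /\<^sub>R fact n) \<le> (\<Sum>n. real m ^ n /\<^sub>R fact n)"
    by (intro sum_le_suminf summable_exp_generic) auto
  then show ?thesis by (simp add: exp_def field_simps)
qed

context pattern_cube
begin

definition scale :: "nat \<Rightarrow> real" where
  "scale n = real n powr (1 / (real r - real t))"

lemma diff_pos: "r - t \<ge> 1" and t_less_r: "t < r"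
  using t_less_s s_le_r by simp_all

lemma scale_power: "n \<ge> 1 \<Longrightarrow> scale n ^ (r - t) = real n"
  using t_less_r by (simp add: scale_def powr_powr of_nat_diff flip: powr_realpow)

lemma scale_ge_0: "scale n \<ge> 0"
  by (simp add: scale_def)

lemma scale_at_top: "filterlim scale at_top sequentially"
proof -
  define a where "a = 1 / (real r - real t)"
  have "a > 0" using t_less_r by (simp add: a_def)
  then have "filterlim (\<lambda>n. exp (a * ln (real n))) at_top sequentially"
    by (intro filterlim_compose[OF exp_at_top] filterlim_tendsto_pos_mult_at_top[OF tendsto_const]
        filterlim_compose[OF ln_at_top filterlim_real_sequentially])
  moreover have "\<forall>\<^sub>F n in sequentially. exp (a * ln (real n)) = scale n"
    using eventually_gt_at_top[of 0] by eventually_elim (simp add: scale_def powr_def a_def)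
  ultimately show ?thesis by (rule iffD1[OF filterlim_cong[OF refl refl], rotated])
qed

text \<open>One exact size suffices to exclude all larger ones, since subsets of cliques are
  cliques.\<close>

lemma clique_upper:
  "\<exists>C\<ge>1. (\<lambda>n. real (card {M\<in>matchings r n. \<exists>K\<subseteq>M. clique K \<and> card K = nat \<lceil>C * scale n\<rceil>})
     / mcount r n) \<longlonglongrightarrow> 0"
proof -
  let ?d = "r - t"
  \<comment> \<open>The first moment will be at most \<open>(D * n / k ^ (r - t)) ^ k\<close>. With
    \<open>C = 2 * D\<close> and \<open>C \<le> C ^ (r - t)\<close>, the base is at most
    1/2.\<close>
  define D where "D = fact r * exp (real r)"
  have D: "D \<ge> 1"
    unfolding D_def using mult_mono[of 1 "fact r :: real" 1 "exp (real r)"] by simp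
  define C where "C = 2 * D"
  define k where "k n = nat \<lceil>C * scale n\<rceil>" for n
  have klim: "filterlim k at_top sequentially"
  proof -
    have "filterlim (\<lambda>n. C * scale n) at_top sequentially"
      using D by (intro filterlim_tendsto_pos_mult_at_top[OF tendsto_const _ scale_at_top])
        (simp add: C_def)
    then have "filterlim (\<lambda>n. real (k n)) at_top sequentially"
      by (rule filterlim_at_top_mono) (simp add: k_def real_nat_ceiling_ge)
    then show ?thesis by (simp add: filterlim_sequentially_iff_filterlim_real)
  qed
  have bound: "real (card {M\<in>matchings r n. \<exists>K\<subseteq>M. clique K \<and> card K = k n}) / mcount r n
      \<le> (1 / 2) ^ k n" if n: "n \<ge> 1" for n
  proof -
    let ?k = "k n"
    have kC: "C * scale n \<le> real ?k" by (simp add: k_def real_nat_ceiling_ge)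
    have "scale n > 0" using n by (simp add: scale_def)
    then have "0 < C * scale n" using D by (simp add: C_def)
    then have k1: "real ?k > 0" using kC by linarith
    have "C * real n \<le> C ^ ?d * real n"
      using D diff_pos power_increasing[of 1 ?d C] by (intro mult_right_mono) (auto simp: C_def)
    also have "\<dots> = (C * scale n) ^ ?d" by (simp add: power_mult_distrib scale_power[OF n])
    also have "\<dots> \<le> real ?k ^ ?d"
      using kC scale_ge_0 D by (intro power_mono) (auto simp: C_def)
    finally have kd: "2 * (D * real n) \<le> real ?k ^ ?d" by (simp add: C_def)
    \<comment> \<open>Dropping the factor \<open>r\<close> from the base only worsens the constant
      and leaves a bound that is a pure \<open>k\<close>-th power.\<close>
    have "real ?k ^ (r * ?k) \<le> real (r * ?k) ^ (r * ?k)"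
      using mult_le_mono1[OF r_pos, of ?k] by (intro power_mono of_nat_mono) auto
    also have "\<dots> \<le> fact (r * ?k) * exp (real (r * ?k))" by (rule power_self_le_fact_exp)
    finally have f: "real ?k ^ (r * ?k) \<le> fact (r * ?k) * exp (real (r * ?k))" .
    have "real (card {M\<in>matchings r n. \<exists>K\<subseteq>M. clique K \<and> card K = ?k}) / mcount r n \<le>
        real ?k ^ (t * ?k) * (fact r * real n) ^ ?k / fact (r * ?k)"
      using card_matchings_clique_le[of n ?k] mcount_pos[of r n] by (simp add: divide_le_eq)
    also have "\<dots> \<le> real ?k ^ (t * ?k) * (fact r * real n) ^ ?k *
        (exp (real (r * ?k)) / real ?k ^ (r * ?k))"
    proof -
      have "1 / fact (r * ?k) \<le> exp (real (r * ?k)) / real ?k ^ (r * ?k)"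
        using f k1 by (simp add: field_simps)
      then have "real ?k ^ (t * ?k) * (fact r * real n) ^ ?k * (1 / fact (r * ?k)) \<le>
          real ?k ^ (t * ?k) * (fact r * real n) ^ ?k * (exp (real (r * ?k)) / real ?k ^ (r * ?k))"
        by (intro mult_left_mono) auto
      then show ?thesis by simp
    qed
    also have "\<dots> = (real ?k ^ t * (fact r * real n) * (exp (real r) / real ?k ^ r)) ^ ?k"
      by (simp add: power_mult power_mult_distrib power_divide exp_of_nat_mult[symmetric] mult.commute)
    also have "real ?k ^ t * (fact r * real n) * (exp (real r) / real ?k ^ r) =
        D * real n / real ?k ^ ?d"
    proof -
      have "real ?k ^ r = real ?k ^ t * real ?k ^ ?d" using t_less_r by (simp flip: power_add)
      then show ?thesis using k1 by (simp add: D_def)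
    qed
    also have "(D * real n / real ?k ^ ?d) ^ ?k \<le> (1 / 2) ^ ?k"
      using kd D k1 by (intro power_mono) (auto simp: divide_le_eq)
    finally show ?thesis .
  qed
  have "(\<lambda>n. real (card {M\<in>matchings r n. \<exists>K\<subseteq>M. clique K \<and> card K = k n}) / mcount r n)
      \<longlonglongrightarrow> 0"
  proof (rule tendsto_sandwich[OF _ _ tendsto_const])
    show "(\<lambda>n. (1 / 2 :: real) ^ k n) \<longlonglongrightarrow> 0"
      by (rule filterlim_compose[OF LIMSEQ_realpow_zero klim]) auto
    show "\<forall>\<^sub>F n in sequentially. real (card {M\<in>matchings r n. \<exists>K\<subseteq>M. clique K \<and> card K = k n}) /
        mcount r n \<le> (1 / 2) ^ k n"
      using bound by (auto simp: eventually_sequentially)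
    show "\<forall>\<^sub>F n in sequentially. 0 \<le> real (card {M\<in>matchings r n. \<exists>K\<subseteq>M. clique K \<and> card K = k n}) /
        mcount r n"
      by (auto intro!: always_eventually divide_nonneg_pos mcount_pos)
  qed
  then show ?thesis using D by (intro exI[of _ C]) (auto simp: C_def k_def)
qed

text \<open>The \<open>+ 1\<close> reflects that outside the bad event some clique has more than
  \<open>u n\<close> edges; it also absorbs the rounding, so the bound holds for every
  \<open>n\<close>.\<close>

lemma clique_lower:
  "\<exists>c u. 0 < c \<and> c < 1 \<and> (\<forall>n. c * scale n \<le> real (u n) + 1) \<and>
    (\<lambda>n. real (card {M\<in>matchings r n. \<forall>K\<subseteq>M. clique K \<longrightarrow> card K \<le> u n}) / mcount r n)
      \<longlonglongrightarrow> 0"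
proof -
  let ?d = "r - t"
  \<comment> \<open>Chosen so that \<open>p * J \<ge> \<kappa> * (n / N ^ (r - t)) * N\<close>. The
    three factors come from \<open>b \<ge> N / 8\<close>, from
    \<open>h / (r * (r * n)) \<ge> 1 / (8 * r ^ 2 * N)\<close> and from
    \<open>J \<ge> n / (128 * r)\<close>.\<close>
  define \<kappa> :: real where "\<kappa> = (1 / 8) ^ Suc t * (1 / (8 * real r ^ 2)) ^ r / (128 * real r)"
  have r0: "real r > 0" using r_pos by simp
  have \<kappa>: "\<kappa> > 0" using r0 by (simp add: \<kappa>_def)
  \<comment> \<open>The summand \<open>2 * r\<close> makes boxes long enough for
    \<open>r \<le> h\<close>. The other one gives \<open>\<kappa> * B \<ge> t + 2\<close>, which
    beats the exponent \<open>t + 1\<close> of the union bound by one.\<close>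
  define B where "B = 2 * r + nat \<lceil>(real t + 2) / \<kappa>\<rceil>"
  have "(real t + 2) / \<kappa> \<le> real B" unfolding B_def using real_nat_ceiling_ge[of "(real t + 2) / \<kappa>"]
    by simp
  then have B\<kappa>: "real t + 2 \<le> \<kappa> * real B" using \<kappa> by (simp add: divide_le_eq mult.commute)
  have B2: "2 * r \<le> B" "B \<ge> 2" using r_pos by (auto simp: B_def)
  define N where "N n = nat \<lfloor>scale n / real B\<rfloor>" for n
  define u where "u n = N n div 4" for n
  have N_le: "real (N n) \<le> scale n / real B" for n
    unfolding N_def using scale_ge_0 by (simp add: of_nat_floor)
  have N_gt: "scale n / real B < real (N n) + 1" for n
    unfolding N_def by linarith
  have Nlim: "filterlim N at_top sequentially"
  proof -
    have "filterlim (\<lambda>n. 1 / real B * scale n) at_top sequentially"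
      using B2 by (intro filterlim_tendsto_pos_mult_at_top[OF tendsto_const _ scale_at_top]) simp
    then have "filterlim (\<lambda>n. - 1 + 1 / real B * scale n) at_top sequentially"
      by (rule filterlim_tendsto_add_at_top[OF tendsto_const])
    then have "filterlim (\<lambda>n. real (N n)) at_top sequentially"
      by (rule filterlim_at_top_mono)
        (use N_gt in \<open>auto intro!: always_eventually simp: less_imp_le algebra_simps\<close>)
    then show ?thesis by (simp add: filterlim_sequentially_iff_filterlim_real)
  qed
  have u: "1 / (4 * real B) * scale n \<le> real (u n) + 1" for n
  proof -
    have "N n + 1 \<le> 4 * (u n + 1)" by (simp add: u_def)
    then have "real (N n + 1) \<le> real (4 * (u n + 1))" by (simp only: of_nat_le_iff)
    then have "real (N n) + 1 \<le> 4 * (real (u n) + 1)" by simp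
    then have "scale n / real B \<le> 4 * (real (u n) + 1)" using N_gt[of n] by linarith
    then show ?thesis by (simp add: field_simps)
  qed
  have bound: "real (card {M\<in>matchings r n. \<forall>K\<subseteq>M. clique K \<longrightarrow> card K \<le> u n}) / mcount r n
      \<le> exp (- real (N n))" if n: "n \<ge> 1" and N4: "N n \<ge> 4" for n
  proof -
    let ?N = "N n"
    \<comment> \<open>A box counts as depleted when fewer than \<open>h\<close>, about half, of its
      vertices are left. Of the \<open>N\<close> values of a coordinate a quarter may be used, a
      quarter may be depleted, and \<open>b\<close> are kept as good ones. \<open>J\<close> is the
      largest number of exposures with \<open>r * J \<le> h * b\<close>.\<close>
    define L where "L = n div ?N"
    define h where "h = L div 2"
    define b where "b = ?N div 4"
    define J where "J = h * b div r"
    define p where "p = real b ^ Suc t * (real h / real r) ^ r / (real r * real n) ^ r"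
    have "real B * real ?N \<le> scale n" using N_le[of n] B2 by (simp add: field_simps)
    then have "(real B * real ?N) ^ ?d \<le> real n"
      using power_mono[of "real B * real ?N" "scale n" ?d] scale_power[OF n] by simp
    then have Bd: "real B ^ ?d * real ?N ^ ?d \<le> real n" by (simp add: power_mult_distrib)
    have B1: "real B \<le> real B ^ ?d" using power_increasing[of 1 ?d "real B"] diff_pos B2 by simp
    have N1: "real ?N \<le> real ?N ^ ?d" using power_increasing[of 1 ?d "real ?N"] diff_pos N4 by simp
    have "real B * real ?N \<le> real B ^ ?d * real ?N ^ ?d"
      using B1 N1 by (intro mult_mono) auto
    then have "real (B * ?N) \<le> real n" using Bd by simp
    then have BN: "B * ?N \<le> n" by (simp only: of_nat_le_iff)
    then have LB: "B \<le> L" unfolding L_def using N4 by (simp add: less_eq_div_iff_mult_less_eq)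
    have NL: "?N * L \<le> n" by (simp add: L_def)
    have hL: "2 * h \<le> L" by (simp add: h_def)
    have rh: "r \<le> h" using LB B2 by (simp add: h_def)
    have Jn: "J \<le> n"
    proof -
      have "J \<le> h * b" by (simp add: J_def)
      also have "\<dots> \<le> L * ?N" by (intro mult_le_mono) (auto simp: h_def b_def)
      finally show ?thesis using NL by (simp add: mult.commute)
    qed
    have few: "real (card {M\<in>matchings r n. \<forall>K\<subseteq>M. clique K \<longrightarrow> card K \<le> u n}) \<le>
        2 ^ (?N * Suc t) * (1 - p) ^ J * mcount r n" and p1: "p \<le> 1"
    proof -
      have "s * ?N * L = s * (?N * L)" by (simp only: mult.assoc)
      also have "\<dots> \<le> r * n" using s_le_r NL by (rule mult_le_mono)
      finally have "s * ?N * L \<le> r * n" .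
      moreover have "r * J \<le> h * b" by (simp add: J_def)
      moreover have "b + u n + b \<le> ?N" by (simp add: b_def u_def)
      ultimately show "real (card {M\<in>matchings r n. \<forall>K\<subseteq>M. clique K \<longrightarrow> card K \<le> u n}) \<le>
        2 ^ (?N * Suc t) * (1 - p) ^ J * mcount r n" "p \<le> 1"
        using card_matchings_few_le[OF _ hL rh _ _ Jn p_def] by blast+
    qed
    \<comment> \<open>For \<open>N \<ge> 4\<close>, rounding down in \<open>N div 4\<close> costs at
      most a factor of two.\<close>
    have "?N \<le> 8 * b" using N4 unfolding b_def by presburger
    then have "real ?N \<le> real (8 * b)" by (simp only: of_nat_le_iff)
    then have bN: "real ?N / 8 \<le> real b" by simp
    have hn: "real n / (8 * real ?N) \<le> real h"
    proof -
      have n_less: "n < (L + 1) * ?N" unfolding L_def using N4 dividend_less_div_times[of ?N n] by simp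
      have "L \<ge> 2" using LB B2 by linarith
      then have "L + 1 \<le> 4 * h" unfolding h_def by presburger
      then have "(L + 1) * ?N \<le> 4 * h * ?N" by (intro mult_le_mono1)
      then have "real n \<le> real (4 * h * ?N)" unfolding of_nat_le_iff using n_less by linarith
      then show ?thesis using N4 by (simp add: field_simps)
    qed
    have pge: "(real ?N / 8) ^ Suc t * (1 / (8 * real r ^ 2 * real ?N)) ^ r \<le> p"
    proof -
      have "1 / (8 * real r ^ 2 * real ?N) = real n / (8 * real ?N) / real r / (real r * real n)"
        using n by (simp add: power2_eq_square)
      also have "\<dots> \<le> real h / real r / (real r * real n)"
        using hn by (intro divide_right_mono) auto
      finally have "(1 / (8 * real r ^ 2 * real ?N)) ^ r \<le> (real h / real r / (real r * real n)) ^ r"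
        by (intro power_mono) auto
      then have "(real ?N / 8) ^ Suc t * (1 / (8 * real r ^ 2 * real ?N)) ^ r \<le>
          real b ^ Suc t * (real h / real r / (real r * real n)) ^ r"
        using power_mono[OF bN, of "Suc t"] by (intro mult_mono) auto
      then show ?thesis by (simp only: p_def power_divide times_divide_eq_right)
    qed
    have Jge: "real n / (128 * real r) \<le> real J"
    proof -
      \<comment> \<open>This makes \<open>J\<close> at least 1, so rounding down in its definition
        also costs at most a factor of two.\<close>
      have "r * 1 \<le> h * b" using rh N4 by (intro mult_le_mono) (auto simp: b_def)
      then have "h * b div r \<ge> 1" using r_pos by (simp add: Suc_le_eq div_greater_zero_iff)
      then have "h * b \<le> 2 * (r * J)"
        using mult_div_mod_eq[of r "h * b"] mod_less_divisor[of r "h * b"] r_pos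
          mult_le_mono2[of 1 J r] unfolding J_def by linarith
      then have "real (h * b) \<le> real (2 * (r * J))" by (simp only: of_nat_le_iff)
      moreover have "real n / (8 * real ?N) * (real ?N / 8) \<le> real h * real b"
        using hn bN by (intro mult_mono) auto
      moreover have "real n / (8 * real ?N) * (real ?N / 8) = real n / 64" using N4 by simp
      ultimately have "real n / 64 \<le> 2 * (real r * real J)" by simp
      then show ?thesis using r0 by (simp add: field_simps)
    qed
    \<comment> \<open>Here the choice of \<open>N\<close> enters:
      \<open>(B * N) ^ (r - t) \<le> n\<close> turns the constant \<open>B\<close> into a lower
      bound for \<open>n / N ^ (r - t)\<close>.\<close>
    have "(real t + 2) * real ?N \<le> \<kappa> * real B * real ?N"
      using B\<kappa> by (intro mult_right_mono) auto
    also have "\<dots> \<le> \<kappa> * real B ^ ?d * real ?N"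
      using B1 \<kappa> by (intro mult_right_mono mult_left_mono) auto
    also have "\<dots> \<le> \<kappa> * (real n / real ?N ^ ?d) * real ?N"
      using Bd N4 \<kappa> by (intro mult_right_mono mult_left_mono) (auto simp: le_divide_eq)
    also have "\<dots> = (real ?N / 8) ^ Suc t * (1 / (8 * real r ^ 2 * real ?N)) ^ r * (real n / (128 * real r))"
    proof -
      have "real ?N ^ r = real ?N ^ t * real ?N ^ ?d" using t_less_r by (simp flip: power_add)
      then show ?thesis using N4 by (simp add: \<kappa>_def power_divide power_mult_distrib ac_simps)
    qed
    also have "\<dots> \<le> p * real J"
      using pge Jge by (intro mult_mono) (auto simp: p_def)
    finally have pJ: "(real t + 2) * real ?N \<le> p * real J" .
    have "(1 - p) ^ J \<le> exp (- p) ^ J"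
      using p1 exp_ge_add_one_self[of "- p"] by (intro power_mono) auto
    also have "\<dots> = exp (- (p * real J))" by (simp add: exp_of_nat_mult[symmetric] mult.commute)
    also have "\<dots> \<le> exp (- ((real t + 2) * real ?N))" using pJ by simp
    finally have e1: "(1 - p) ^ J \<le> exp (- ((real t + 2) * real ?N))" .
    \<comment> \<open>With 2 replaced by \<open>exp 1\<close>, the two exponents differ by exactly
      \<open>N\<close>.\<close>
    have "(2::real) ^ (?N * Suc t) \<le> exp 1 ^ (?N * Suc t)"
      using exp_ge_add_one_self[of 1] by (intro power_mono) auto
    also have "\<dots> = exp ((real t + 1) * real ?N)"
      by (simp add: exp_of_nat_mult[symmetric] algebra_simps)
    finally have "2 ^ (?N * Suc t) * (1 - p) ^ J \<le>
        exp ((real t + 1) * real ?N) * exp (- ((real t + 2) * real ?N))"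
      using e1 p1 by (intro mult_mono) auto
    also have "\<dots> = exp (- real ?N)" by (simp add: mult_exp_exp algebra_simps)
    finally have "2 ^ (?N * Suc t) * (1 - p) ^ J * mcount r n \<le> exp (- real ?N) * mcount r n"
      using mcount_pos[of r n] by (intro mult_right_mono) auto
    with few have "real (card {M\<in>matchings r n. \<forall>K\<subseteq>M. clique K \<longrightarrow> card K \<le> u n}) \<le>
        exp (- real ?N) * mcount r n"
      by (rule order_trans)
    then show ?thesis using mcount_pos[of r n] by (simp add: divide_le_eq)
  qed
  have "(\<lambda>n. real (card {M\<in>matchings r n. \<forall>K\<subseteq>M. clique K \<longrightarrow> card K \<le> u n}) / mcount r n)
      \<longlonglongrightarrow> 0"
  proof (rule tendsto_sandwich[OF _ _ tendsto_const])
    show "(\<lambda>n. exp (- real (N n))) \<longlonglongrightarrow> 0"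
      using filterlim_compose[OF filterlim_real_sequentially Nlim]
      by (intro filterlim_compose[OF exp_at_bot])
        (simp add: filterlim_uminus_at_bot_at_top filterlim_uminus_at_bot)
    show "\<forall>\<^sub>F n in sequentially. real (card {M\<in>matchings r n. \<forall>K\<subseteq>M. clique K \<longrightarrow> card K \<le> u n}) /
        mcount r n \<le> exp (- real (N n))"
      using eventually_ge_at_top[of 1] Nlim[unfolded filterlim_at_top, rule_format, of 4]
      by eventually_elim (rule bound)
    show "\<forall>\<^sub>F n in sequentially. 0 \<le> real (card {M\<in>matchings r n. \<forall>K\<subseteq>M. clique K \<longrightarrow> card K \<le> u n}) /
        mcount r n"
      by (auto intro!: always_eventually divide_nonneg_pos mcount_pos)
  qed
  moreover have "0 < 1 / (4 * real B)" "1 / (4 * real B) < 1" using B2 by auto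
  ultimately show ?thesis using u by blast
qed

end

section \<open>From vanishing exceptional sets to probability tending to one\<close>

lemma tendsto_prob_one:
  fixes S A F G :: "nat \<Rightarrow> 'a set" and m :: "nat \<Rightarrow> real"
  assumes S: "\<And>n. finite (S n)" "\<And>n. S n \<noteq> {}" "\<And>n. real (card (S n)) = m n"
    and sub: "\<And>n. S n - A n \<subseteq> F n \<union> G n" "\<And>n. F n \<subseteq> S n" "\<And>n. G n \<subseteq> S n"
    and lim: "(\<lambda>n. real (card (F n)) / m n) \<longlonglongrightarrow> 0" "(\<lambda>n. real (card (G n)) / m n) \<longlonglongrightarrow> 0"
  shows "(\<lambda>n. measure_pmf.prob (pmf_of_set (S n)) (A n)) \<longlonglongrightarrow> 1"
proof (rule tendsto_sandwich[OF _ _ _ tendsto_const])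
  show "(\<lambda>n. 1 - real (card (F n)) / m n - real (card (G n)) / m n) \<longlonglongrightarrow> 1"
    using tendsto_diff[OF tendsto_diff[OF tendsto_const[of 1] lim(1)] lim(2)] by simp
  show "\<forall>\<^sub>F n in sequentially. 1 - real (card (F n)) / m n - real (card (G n)) / m n \<le>
      measure_pmf.prob (pmf_of_set (S n)) (A n)"
  proof (intro always_eventually allI)
    fix n
    have m: "m n > 0" unfolding S(3)[symmetric] using S(1,2) by (simp add: card_gt_0_iff)
    have fin: "finite (F n)" "finite (G n)" 
      by (rule finite_subset[OF sub(2) S(1)] finite_subset[OF sub(3) S(1)])+
    have "card (S n) \<le> card (S n \<inter> A n \<union> (F n \<union> G n))"
      using fin S(1) sub(1)[of n] by (intro card_mono) auto
    also have "\<dots> \<le> card (S n \<inter> A n) + (card (F n) + card (G n))"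
      by (intro order_trans[OF card_Un_le] add_left_mono card_Un_le)
    finally have "m n \<le> real (card (S n \<inter> A n)) + (real (card (F n)) + real (card (G n)))"
      unfolding S(3)[symmetric] by (simp flip: of_nat_add)
    then have "1 \<le> (real (card (S n \<inter> A n)) + (real (card (F n)) + real (card (G n)))) / m n"
      using m by simp
    then have "1 - real (card (F n)) / m n - real (card (G n)) / m n \<le> real (card (S n \<inter> A n)) / m n"
      unfolding add_divide_distrib by linarith
    then show "1 - real (card (F n)) / m n - real (card (G n)) / m n \<le>
        measure_pmf.prob (pmf_of_set (S n)) (A n)"
      using S by (simp add: measure_pmf_of_set)
  qed
  show "\<forall>\<^sub>F n in sequentially. measure_pmf.prob (pmf_of_set (S n)) (A n) \<le> 1"
    by (intro always_eventually allI measure_pmf.prob_le_1)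
qed

section \<open>Passing between pattern cliques and the abstract cube\<close>

lemma pattern_clique_iff:
  assumes "r \<ge> 1"
  shows "pattern_clique r \<P> K \<longleftrightarrow> finite K \<and> disjoint K \<and> (\<forall>e\<in>K. card e = r) \<and>
     (\<forall>e\<in>K. \<forall>f\<in>K. e \<noteq> f \<longrightarrow>
        (\<exists>w\<in>\<P>. order_isomorphic (e \<union> f) {e, f} {..<length w} (word_edges w)))"
proof -
  have "(\<exists>m. ordered_matching r m (\<Union>K) K) \<longleftrightarrow> finite K \<and> disjoint K \<and> (\<forall>e\<in>K. card e = r)"
  proof
    assume K: "finite K \<and> disjoint K \<and> (\<forall>e\<in>K. card e = r)"
    then have "finite e" if "e \<in> K" for e using that assms card_ge_0_finite[of e] by simp
    then have "ordered_matching r (card K) (\<Union>K) K"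
      using K card_Union_uniform[of K r] assms by (auto simp: ordered_matching_def)
    then show "\<exists>m. ordered_matching r m (\<Union>K) K" ..
  qed (auto simp: ordered_matching_def)
  then show ?thesis by (auto simp: pattern_clique_def)
qed

lemma card_le_max_clique:
  assumes "finite M" "K \<subseteq> M" "pattern_clique r \<P> K"
  shows "card K \<le> max_clique r \<P> M"
  unfolding max_clique_def using assms by (intro Max_ge) auto

lemma max_clique_obtain:
  assumes "finite M" "r \<ge> 1"
  obtains K where "K \<subseteq> M" "pattern_clique r \<P> K" "card K = max_clique r \<P> M"
proof -
  let ?S = "{card K | K. K \<subseteq> M \<and> pattern_clique r \<P> K}"
  have "pattern_clique r \<P> {}" using assms(2) by (simp add: pattern_clique_iff)
  then have "card ({} :: 'a set set) \<in> ?S" by blast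
  then have "?S \<noteq> {}" by blast
  moreover have "finite ?S" using assms(1) by auto
  ultimately have "Max ?S \<in> ?S" by (intro Max_in)
  then obtain K where "K \<subseteq> M" "pattern_clique r \<P> K" "Max ?S = card K" by auto
  then show ?thesis using that[of K] by (simp add: max_clique_def)
qed

lemma (in pattern_cube) clique_subset:
  assumes "clique K" "K' \<subseteq> K"
  shows "clique K'"
proof -
  have "disjoint K'" using pairwise_subset[of disjnt K K'] assms by (simp add: clique_def)
  then show ?thesis using assms finite_subset[OF assms(2)] unfolding clique_def
    by (intro conjI ballI impI) (simp_all add: subset_iff)
qed

lemma separated_cong:
  assumes "finite X" "finite Y" "\<And>p q. p < card X \<Longrightarrow> q < card Y \<Longrightarrow> R p q \<longleftrightarrow> R' p q"
  shows "separated R X Y \<longleftrightarrow> separated R' X Y"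
proof -
  have "idx X x < card X" if "x \<in> X" for x
    using bij_betwE[OF bij_betw_idx[OF assms(1)]] that by auto
  moreover have "idx Y y < card Y" if "y \<in> Y" for y
    using bij_betwE[OF bij_betw_idx[OF assms(2)]] that by auto
  ultimately show ?thesis unfolding separated_def by (intro ball_cong refl) (simp add: assms(3))
qed

lemma block_flip:
  assumes "block S"
  shows "block (map flip_letter S)"
proof -
  obtain l c where "l \<ge> 1" "S = replicate l c @ replicate l (flip_letter c)"
    using assms by (rule blockE)
  then show ?thesis unfolding block_def by (cases c) auto
qed

theorem theorem2p5:
  fixes r s t :: nat and P :: "letter list" and T :: "nat \<Rightarrow> nat set"
  assumes "r \<ge> 2"
    and "collectable r P"
    and "length (composition P) = s"
    and "block_partition s t T"
  shows "\<exists>c C :: real. 0 < c \<and> c < C \<and>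
    (\<lambda>n. measure_pmf.prob (random_matching r n)
       {M. c * real n powr (1 / (real r - real t)) \<le> real (max_clique r (cube P t T) M) \<and>
           real (max_clique r (cube P t T) M) \<le> C * real n powr (1 / (real r - real t))})
      \<longlonglongrightarrow> 1"
proof -
  obtain Ss where Ss: "concat Ss = P" "\<forall>S\<in>set Ss. block S" and blocks: "blocks P = Ss"
    using assms(2) blocks_eq by (auto simp: collectable_def splitting_def)
  define ls where "ls = map (\<lambda>S. length S div 2) Ss"
  have s: "s = length Ss" "s = length ls" using assms(3) by (simp_all add: composition_def blocks ls_def)
  have r: "sum_list ls = r"
    using count_concat_blocks[OF Ss(2), of LA] assms(2) Ss(1)
    by (simp add: ls_def collectable_def pattern_def)
  have ls1: "\<forall>l\<in>set ls. l \<ge> 1" using Ss(2) by (auto simp: ls_def elim!: blockE)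
  have T: "(\<Union>j\<in>{0..t}. T j) = {1..s}" "disjoint_family_on T {0..t}" "\<forall>j\<in>{0..t}. T j \<noteq> {}"
    using assms(4) by (auto simp: block_partition_def)
  \<comment> \<open>Blocks are counted from 0 here and from 1 in \<open>T\<close>, hence the
    \<open>Suc\<close>. Disjointness of the parts makes the description unique.\<close>
  define mega where "mega i = (THE j. j \<le> t \<and> Suc i \<in> T j)" for i
  have mega: "mega i = j" if "j \<le> t" "Suc i \<in> T j" for i j
    unfolding mega_def
  proof (rule the_equality)
    fix j' assume "j' \<le> t \<and> Suc i \<in> T j'"
    then show "j' = j" using disjoint_family_onD[OF T(2), of j' j] that by fastforce
  qed (use that in simp)
  have mega_in: "mega i \<le> t \<and> Suc i \<in> T (mega i)" if "i < s" for i
  proof -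
    have "Suc i \<in> (\<Union>j\<in>{0..t}. T j)" using that T(1) by simp
    then show ?thesis using mega by auto
  qed
  define up where "up i \<longleftrightarrow> hd (Ss ! i) = LA" for i
  interpret pattern_cube r s t "blk ls" up mega
  proof
    show "blk ls ` {..<r} = {..<s}"
      using blk_less[of _ ls] blk_surj[OF ls1] r s(2) by (auto simp: image_iff)
    show "mega ` {..<s} = {..t}"
    proof (intro equalityI subsetI)
      fix j assume "j \<in> {..t}"
      then have j: "j \<le> t" by simp
      then obtain x where "x \<in> T j" using T(3) by fastforce
      moreover from this have "x \<in> {1..s}" using T(1) j by fastforce
      then obtain i where "x = Suc i" "i < s" by (cases x) auto
      ultimately show "j \<in> mega ` {..<s}" using mega[OF j, of i] by auto
    qed (use mega_in in auto)
  qed (rule blk_mono)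

  have iso: "order_isomorphic (e \<union> f) {e, f} {..<length (flip_pattern P T F)}
      (word_edges (flip_pattern P T F)) \<longleftrightarrow> separated (before F) e f \<or> separated (before F) f e"
    if F: "F \<subseteq> {1..t}" and ef: "finite e" "finite f" "e \<inter> f = {}" "card e = r" "card f = r"
    for F and e f :: "nat set"
  proof -
    \<comment> \<open>The flipped pattern is again a concatenation of blocks with the same
      composition \<open>ls\<close>. Only the first letters of the blocks in flipped mega-blocks
      change, so the description of words by blocks applies to it as well.\<close>
    define Rs where "Rs = map (\<lambda>i. if mega i \<in> F then map flip_letter (Ss ! i) else Ss ! i) [0..<s]"
    have bS: "block (Ss ! i)" if "i < s" for i using that Ss(2) s(1) by simp
    have bR: "\<forall>S\<in>set Rs. block S" using bS block_flip by (auto simp: Rs_def)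
    have flipped: "(\<exists>j\<in>F. Suc i \<in> T j) \<longleftrightarrow> mega i \<in> F" if "i < s" for i
    proof
      assume "\<exists>j\<in>F. Suc i \<in> T j"
      then obtain j where "j \<in> F" "Suc i \<in> T j" by blast
      moreover from this have "j \<le> t" using F by auto
      ultimately show "mega i \<in> F" using mega by simp
    next
      assume "mega i \<in> F"
      then show "\<exists>j\<in>F. Suc i \<in> T j" using mega_in[OF that] by blast
    qed
    have w: "flip_pattern P T F = concat Rs"
      unfolding flip_pattern_def blocks Rs_def s(1)[symmetric]
      by (intro arg_cong[where f = concat] map_cong refl) (simp add: flipped)
    have lR: "map (\<lambda>S. length S div 2) Rs = ls"
      by (rule nth_equalityI) (auto simp: Rs_def ls_def s(1))
    have hdR: "hd (Rs ! i) = LA \<longleftrightarrow> (up i \<longleftrightarrow> mega i \<notin> F)" if "i < s" for i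
    proof -
      have "Ss ! i \<noteq> []" using bS[OF that] by (auto elim!: blockE)
      then show ?thesis using that
        by (cases "hd (Ss ! i)"; cases "mega i \<in> F") (simp_all add: Rs_def up_def hd_map)
    qed
    have cR: "card (positions (concat Rs) c) = r" for c
      using count_concat_blocks[OF bR, of c] unfolding lR r card_positions .
    \<comment> \<open>The orientation of block \<open>i\<close> is known only for
      \<open>i < s\<close>, so the two relations are compared at indices below \<open>r\<close>, the
      only ones that occur.\<close>
    have "separated (before F) (positions (concat Rs) LA) (positions (concat Rs) LB)"
      using separated_concat_blocks[OF bR lR[symmetric]]
    proof (subst separated_cong)
      fix p q assume "p < card (positions (concat Rs) LA)"
      then have "blk ls p < s" using blk_less[of p ls] r s(2) cR[of LA] by simp
      then show "before F p q \<longleftrightarrow> blk ls p < blk ls q \<or> blk ls p = blk ls q \<and> hd (Rs ! blk ls p) = LA"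
        using hdR by (auto simp: before_def)
    qed auto
    then show ?thesis unfolding w using ef cR by (intro order_isomorphic_word_iff) auto
  qed
  have clique_iff: "pattern_clique r (cube P t T) K \<longleftrightarrow> clique K" for K :: "nat set set"
  proof -
    have "(\<exists>w\<in>cube P t T. order_isomorphic (e \<union> f) {e, f} {..<length w} (word_edges w)) \<longleftrightarrow>
        compatible e f"
      if "disjoint K" "\<forall>e\<in>K. card e = r" "e \<in> K" "f \<in> K" "e \<noteq> f" for e f
    proof -
      have ef: "finite e" "finite f" "e \<inter> f = {}" "card e = r" "card f = r"
        using that r_pos card_ge_0_finite[of e] card_ge_0_finite[of f]
        by (auto simp: pairwise_def disjnt_def)
      have "(\<exists>w\<in>cube P t T. Q w) \<longleftrightarrow> (\<exists>F\<subseteq>{1..t}. Q (flip_pattern P T F))" for Q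
        unfolding cube_def by blast
      also have "(\<exists>F\<subseteq>{1..t}. order_isomorphic (e \<union> f) {e, f} {..<length (flip_pattern P T F)}
          (word_edges (flip_pattern P T F))) \<longleftrightarrow> compatible e f"
        unfolding compatible_def by (intro ex_cong1 conj_cong refl iso ef)
      finally show ?thesis .
    qed
    then show ?thesis unfolding pattern_clique_iff[OF r_pos] clique_def by blast
  qed

  let ?z = "max_clique r (cube P t T)"
  obtain C where C: "C \<ge> 1" "(\<lambda>n. real (card {M\<in>matchings r n. \<exists>K\<subseteq>M. clique K \<and>
      card K = nat \<lceil>C * scale n\<rceil>}) / mcount r n) \<longlonglongrightarrow> 0"
    using clique_upper by blast
  obtain c u where c: "0 < c" "c < 1" "\<And>n. c * scale n \<le> real (u n) + 1"
    "(\<lambda>n. real (card {M\<in>matchings r n. \<forall>K\<subseteq>M. clique K \<longrightarrow> card K \<le> u n}) / mcount r n) \<longlonglongrightarrow> 0"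
    using clique_lower by blast
  have "(\<lambda>n. measure_pmf.prob (pmf_of_set (matchings r n))
     {M. c * scale n \<le> real (?z M) \<and> real (?z M) \<le> C * scale n}) \<longlonglongrightarrow> 1"
  proof (rule tendsto_prob_one[OF finite_matchings matchings_nonempty[OF r_pos] _ _ _ _ c(4) C(2)])
    fix n
    show "real (card (matchings r n)) = mcount r n"
      using card_avoiding_empty[of "{1..r * n}" r n] matchings_eq_avoiding[OF r_pos] r_pos by simp
    show "matchings r n - {M. c * scale n \<le> real (?z M) \<and> real (?z M) \<le> C * scale n} \<subseteq>
      {M\<in>matchings r n. \<forall>K\<subseteq>M. clique K \<longrightarrow> card K \<le> u n} \<union>
      {M\<in>matchings r n. \<exists>K\<subseteq>M. clique K \<and> card K = nat \<lceil>C * scale n\<rceil>}"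
    proof (rule subsetI, rule ccontr)
      fix M
      assume M: "M \<in> matchings r n - {M. c * scale n \<le> real (?z M) \<and> real (?z M) \<le> C * scale n}"
        and "M \<notin> {M\<in>matchings r n. \<forall>K\<subseteq>M. clique K \<longrightarrow> card K \<le> u n} \<union>
          {M\<in>matchings r n. \<exists>K\<subseteq>M. clique K \<and> card K = nat \<lceil>C * scale n\<rceil>}"
      then obtain K where K: "K \<subseteq> M" "clique K" "u n < card K"
        and none: "\<And>K. K \<subseteq> M \<Longrightarrow> clique K \<Longrightarrow> card K \<noteq> nat \<lceil>C * scale n\<rceil>"
        by (auto simp: not_le)
      have fin: "finite M" using M by (auto simp: matchings_def ordered_matching_def)
      have "card K \<le> ?z M" using card_le_max_clique[OF fin K(1)] K(2) clique_iff by blast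
      then have "real (u n) + 1 \<le> real (?z M)" using K(3) by linarith
      then have "c * scale n \<le> real (?z M)" using c(3)[of n] by linarith
      moreover have "real (?z M) \<le> C * scale n"
      proof (rule ccontr)
        assume "\<not> real (?z M) \<le> C * scale n"
        \<comment> \<open>A largest clique contains a subclique of exactly the excluded
          size.\<close>
        then have le: "nat \<lceil>C * scale n\<rceil> \<le> ?z M" by linarith
        obtain K where K: "K \<subseteq> M" "pattern_clique r (cube P t T) K" "card K = ?z M"
          using max_clique_obtain[OF fin r_pos] .
        have "nat \<lceil>C * scale n\<rceil> \<le> card K" using le K(3) by simp
        then obtain K' where "K' \<subseteq> K" "card K' = nat \<lceil>C * scale n\<rceil>"
          by (rule obtain_subset_with_card_n)
        moreover from this have "clique K'" using K(2) clique_subset[of K K'] by (simp add: clique_iff)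
        ultimately show False using none[of K'] K(1) by auto
      qed
      ultimately show False using M by simp
    qed
  qed auto
  then show ?thesis
    unfolding random_matching_def scale_def using c(1,2) C(1)
    by (intro exI[of _ c] exI[of _ C]) auto
qed

end
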